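(* Let $k\in\{5,9,10,11\}$ or $k\geq 13$. Then there exists a $4$-polytope with exactly $k$ vertices which is $2$-simple, $2$-simplicial and elementary.
   Context: For a $4$-polytope $P$, $f_i$ denotes the number of $i$-dimensional faces and $f_{02}$ the number of pairs (vertex $v$, $2$-face $F$) with $v\in F$. A polytope is $2$-simplicial if all its $2$-dimensional faces are triangles; a $4$-polytope is $2$-simple if every edge is contained in exactly $3$ facets (equivalently, its polar is $2$-simplicial). For a $d$-polytope, $g_2(P)=f_{02}-3f_2+f_1-d f_0+\binom{d+1}{2}$; for $d=4$ this is $f_{02}-3f_2+f_1-4f_0+10$. A polytope is elementary if $g_2(P)=0$. *)

theory Defs
  imports "HOL-Analysis.Analysis"
begin

text \<open>Faces of a polytope P of dimension i (faces in the sense of face_of, i.e. including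
  the empty face of dimension -1 and P itself).\<close>
definition faces_dim :: "int \<Rightarrow> 'a::euclidean_space set \<Rightarrow> 'a set set" where
  "faces_dim i P = {F. F face_of P \<and> aff_dim F = i}"

definition fnum :: "int \<Rightarrow> 'a::euclidean_space set \<Rightarrow> nat" where
  "fnum i P = card (faces_dim i P)"

definition f02 :: "'a::euclidean_space set \<Rightarrow> nat" where
  "f02 P = card {(v, F). {v} \<in> faces_dim 0 P \<and> F \<in> faces_dim 2 P \<and> v \<in> F}"

definition two_simplicial :: "'a::euclidean_space set \<Rightarrow> bool" where
  "two_simplicial P \<longleftrightarrow> (\<forall>F \<in> faces_dim 2 P. 2 simplex F)"

definition two_simple4 :: "'a::euclidean_space set \<Rightarrow> bool" where
  "two_simple4 P \<longleftrightarrow> (\<forall>E \<in> faces_dim 1 P. card {G \<in> faces_dim 3 P. E \<subseteq> G} = 3)"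

definition g2 :: "nat \<Rightarrow> 'a::euclidean_space set \<Rightarrow> int" where
  "g2 d P = int (f02 P) - 3 * int (fnum 2 P) + int (fnum 1 P) - int d * int (fnum 0 P)
            + int ((d + 1) choose 2)"

definition elementary :: "nat \<Rightarrow> 'a::euclidean_space set \<Rightarrow> bool" where
  "elementary d P \<longleftrightarrow> g2 d P = 0"

end

theory Submission
  imports Defs
begin

text \<open>
  A 2-simplicial, 2-simple 4-polytope with \<open>k\<close> vertices is elementary iff it has \<open>4 k - 10\<close> edges. Such
  polytopes are glued as follows. If \<open>R\<close> has a simple vertex \<open>0\<close>, whose neighbours may be taken to be the
  unit vectors \<open>e\<^sub>1, ..., e\<^sub>4\<close>, and \<open>P\<close> has a tetrahedral facet, then \<open>P\<close> can be placed inside the simplex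
  \<open>conv {0, e\<^sub>1, ..., e\<^sub>4}\<close> with the tetrahedron \<open>conv {e\<^sub>1, ..., e\<^sub>4}\<close> as that facet and with its four
  neighbours in the coordinate hyperplanes. Replacing that corner of \<open>R\<close> by \<open>P\<close> merges these four facets
  with the facets of \<open>R\<close> at \<open>0\<close>. No face of dimension at most 2 crosses the tetrahedron, because the 2-faces
  of \<open>R\<close> at \<open>0\<close> are triangles. So the result is again 2-simplicial and 2-simple, with \<open>|P| + |R| - 5\<close> vertices
  and \<open>f\<^sub>1(P) + f\<^sub>1(R) - 10\<close> edges.

  There is such a \<open>P\<close> with 9 vertices that has in addition a simple vertex away from the tetrahedron, so it
  can be glued in repeatedly, adding 4 vertices each time. Starting from the simplex or from an 11-vertex
  polytope and gluing in the 10-vertex hypersimplex at most once at the end gives the vertex numbers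
  \<open>5 + 4 a\<close>, \<open>11 + 4 a\<close>, \<open>10 + 4 a\<close> and \<open>16 + 4 a\<close>.
\<close>

section \<open>Faces of polytopes given by vertices and facets\<close>

text \<open>Replacing a corner must preserve convexity although four pairs of facets become
  coplanar. The coordinates reduce this to signs. A functional of either polytope is zero at 0 (a
  coordinate functional), negative there (the other facets of the inserted piece, apart from the
  tetrahedron) or positive (the facets of \<open>R\<close> away from its corner). In barycentric
  coordinates with respect to 0 and the unit vectors, this sign decides on which side of
  \<open>csum x = 1\<close> the facet can touch the nonnegative orthant. The glued polytope is then
  just the intersection of all remaining half-spaces, and each condition on it is inherited from the
  two pieces; a union of convex bodies is never considered. The projective freedom needed to bring a
  piece into position is spent once, in the coordinates of the explicit examples, so that repeated
  gluing requires only affine maps. 2-faces are never compared across the gluing: it suffices that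
  any two facets have at most three common vertices.\<close>

definition affine_fun :: "('a::euclidean_space \<Rightarrow> real) \<Rightarrow> bool" where
  "affine_fun h \<longleftrightarrow> (\<exists>a b. \<forall>x. h x = a \<bullet> x + b)"

lemma affine_fun_comb:
  assumes "affine_fun h" "s + t = 1"
  shows "h (s *\<^sub>R x + t *\<^sub>R y) = s * h x + t * h y"
proof -
  obtain a b where h: "\<And>x. h x = a \<bullet> x + b"
    using assms(1) unfolding affine_fun_def by blast
  have "h (s *\<^sub>R x + t *\<^sub>R y) = s * (a \<bullet> x) + t * (a \<bullet> y) + (s + t) * b"
    using assms(2) by (simp add: h inner_add_right)
  then show ?thesis by (simp add: h algebra_simps)
qed

lemma affine_fun_zero_affine_hull:
  assumes "affine_fun h" "\<And>v. v \<in> S \<Longrightarrow> h v = 0" "x \<in> affine hull S"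
  shows "h x = 0"
proof -
  have "affine {x. h x = 0}"
    unfolding affine_def using affine_fun_comb[OF assms(1)] by auto
  then have "affine hull S \<subseteq> {x. h x = 0}"
    using assms(2) by (intro hull_minimal) auto
  then show ?thesis using assms(3) by auto
qed

lemma affine_fun_continuous: "affine_fun h \<Longrightarrow> continuous_on S h"
proof -
  assume "affine_fun h"
  then obtain a b where "h = (\<lambda>x. a \<bullet> x + b)" unfolding affine_fun_def by blast
  then show ?thesis by (simp add: continuous_intros)
qed

definition hpoly :: "('a \<Rightarrow> real) set \<Rightarrow> 'a set" where
  "hpoly L = {x. \<forall>h\<in>L. 0 \<le> h x}"

definition zeros :: "'a set \<Rightarrow> ('a \<Rightarrow> real) set \<Rightarrow> 'a set" where
  "zeros V J = {v \<in> V. \<forall>h\<in>J. h v = 0}"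

text \<open>The smallest face containing \<open>u\<close> and \<open>v\<close> has no other listed
  vertex. Only incidences enter, so edges can be compared across a gluing and counted in a boolean
  matrix; \<open>faces_dim_1\<close> identifies them with the 1-faces.\<close>

definition edge_pair :: "'a set \<Rightarrow> ('a \<Rightarrow> real) set \<Rightarrow> 'a \<Rightarrow> 'a \<Rightarrow> bool" where
  "edge_pair V L u v \<longleftrightarrow> u \<in> V \<and> v \<in> V \<and> u \<noteq> v \<and>
     (\<forall>w\<in>V. (\<forall>h\<in>L. h u = 0 \<longrightarrow> h v = 0 \<longrightarrow> h w = 0) \<longrightarrow> w = u \<or> w = v)"

definition edge_set :: "'a set \<Rightarrow> ('a \<Rightarrow> real) set \<Rightarrow> 'a set set" where
  "edge_set V L = {E. \<exists>u v. edge_pair V L u v \<and> E = {u, v}}"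

lemma edge_pair_sym: "edge_pair V L u v \<Longrightarrow> edge_pair V L v u"
  unfolding edge_pair_def by blast

text \<open>Isolates the set of facets through both points, so that an equality between two such
  sets can be rewritten as a whole.\<close>

lemma edge_pair_common:
  "edge_pair V L u v \<longleftrightarrow> u \<in> V \<and> v \<in> V \<and> u \<noteq> v \<and>
     (\<forall>w\<in>V. (\<forall>h\<in>{h \<in> L. h u = 0 \<and> h v = 0}. h w = 0) \<longrightarrow> w = u \<or> w = v)"
  by (auto simp: edge_pair_def)

lemma finite_edge_set: "finite V \<Longrightarrow> finite (edge_set V L)"
  by (rule finite_subset[of _ "Pow V"]) (auto simp: edge_set_def edge_pair_def)

text \<open>Used to refute extremality of \<open>x\<close>, and to put the end \<open>v\<close> into
  any face that contains \<open>x\<close>.\<close>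

lemma between_extension: "e > 0 \<Longrightarrow> x \<noteq> v \<Longrightarrow> x \<in> open_segment v (x + e *\<^sub>R (x - v))"
  for x v :: "'a::euclidean_space"
proof -
  assume e: "e > 0" "x \<noteq> v"
  have "x = (1 - 1/(1+e)) *\<^sub>R v + (1/(1+e)) *\<^sub>R (x + e *\<^sub>R (x - v))"
  proof -
    have "(1 + e) *\<^sub>R ((1 - 1/(1+e)) *\<^sub>R v + (1/(1+e)) *\<^sub>R (x + e *\<^sub>R (x - v))) = (1+e) *\<^sub>R x"
      using e by (simp add: scaleR_add_right scaleR_diff_right field_simps)
    then show ?thesis using e by (auto dest: scaleR_left_imp_eq[rotated])
  qed
  moreover have "v \<noteq> x + e *\<^sub>R (x - v)"
  proof
    assume "v = x + e *\<^sub>R (x - v)"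
    then have "(1 + e) *\<^sub>R (x - v) = 0" by (simp add: algebra_simps)
    then show False using e by auto
  qed
  ultimately show ?thesis using e
    unfolding in_segment(2) by (intro conjI exI[of _ "1/(1+e)"]) (auto simp: field_simps)
qed

text \<open>The vertices and facets of the polytope are listed independently; that the lists belong to the
  same polytope is expressed by \<open>dominated\<close>: the constraints tight at any point of the polyhedron are
  all tight at some listed vertex. This forces every extreme point to be listed.\<close>
locale vh_polytope =
  fixes V :: "'a::euclidean_space set" and L :: "('a \<Rightarrow> real) set"
  assumes finite_V: "finite V" and finite_L: "finite L"
    and affine_L: "h \<in> L \<Longrightarrow> affine_fun h"
    and V_nonneg: "v \<in> V \<Longrightarrow> h \<in> L \<Longrightarrow> 0 \<le> h v"
    and bounded_hpoly: "bounded (hpoly L)"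
    and dominated: "x \<in> hpoly L \<Longrightarrow> \<exists>v\<in>V. \<forall>h\<in>L. h x = 0 \<longrightarrow> h v = 0"
    and vertex_unique: "v \<in> V \<Longrightarrow> w \<in> V \<Longrightarrow> (\<And>h. h \<in> L \<Longrightarrow> h v = 0 \<Longrightarrow> h w = 0) \<Longrightarrow> w = v"
begin

abbreviation "Q \<equiv> hpoly L"

lemma V_subset_Q: "V \<subseteq> Q"
  using V_nonneg by (auto simp: hpoly_def)

lemma zeros_subset: "zeros V J \<subseteq> V"
  by (auto simp: zeros_def)

lemma convex_Q: "convex Q"
proof -
  have "0 \<le> h (s *\<^sub>R x + t *\<^sub>R y)"
    if "x \<in> Q" "y \<in> Q" "0 \<le> s" "0 \<le> t" "s + t = 1" "h \<in> L" for x y s t h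
    using affine_fun_comb[OF affine_L, of h s t x y] that by (simp add: hpoly_def)
  then show ?thesis unfolding convex_def by (simp add: hpoly_def)
qed

lemma closed_Q: "closed Q"
proof -
  have "Q = (\<Inter>h\<in>L. {x. 0 \<le> h x})" by (auto simp: hpoly_def)
  moreover have "closed {x. 0 \<le> h x}" if "h \<in> L" for h
    using affine_fun_continuous[OF affine_L[OF that]] by (intro closed_Collect_le) auto
  ultimately show ?thesis by auto
qed

lemma compact_Q: "compact Q"
  using closed_Q bounded_hpoly by (simp add: compact_eq_bounded_closed)

text \<open>Constraints tight at \<open>x\<close> vanish at \<open>v\<close> too, hence on the whole
  line; the finitely many slack ones tolerate a short step.\<close>

lemma extend_beyond:
  assumes "x \<in> Q" "v \<in> Q" "\<And>h. h \<in> L \<Longrightarrow> h x = 0 \<Longrightarrow> h v = 0"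
  obtains e where "e > 0" "x + e *\<^sub>R (x - v) \<in> Q"
proof -
  have "\<exists>e>0. \<forall>d. 0 < d \<and> d \<le> e \<longrightarrow> 0 \<le> h (x + d *\<^sub>R (x - v))" if h: "h \<in> L" for h
  proof -
    have eq: "h (x + d *\<^sub>R (x - v)) = h x + d * (h x - h v)" for d
      using affine_fun_comb[OF affine_L[OF h], of "1 + d" "- d" x v]
      by (simp add: algebra_simps)
    show ?thesis
    proof (cases "h x = 0")
      case True
      then show ?thesis using assms(3)[OF h] by (intro exI[of _ 1]) (auto simp: eq)
    next
      case False
      have pos: "h x > 0" "h v \<ge> 0" using assms h False by (auto simp: hpoly_def less_le)
      \<comment> \<open>The denominator \<open>h v + 1\<close> is never zero, and the bound still
        yields \<open>d * h v \<le> h x\<close>.\<close>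
      have "0 \<le> h x + d * (h x - h v)" if d: "0 < d" "d \<le> h x / (h v + 1)" for d
      proof -
        have "d * (h v + 1) \<le> h x" using d pos by (simp add: field_simps)
        moreover have "d * h x \<ge> 0" using d pos by simp
        ultimately show ?thesis using d by (simp add: algebra_simps)
      qed
      then show ?thesis using pos by (intro exI[of _ "h x / (h v + 1)"]) (auto simp: eq)
    qed
  qed
  then obtain e where e: "\<And>h. h \<in> L \<Longrightarrow> e h > 0"
    "\<And>h d. h \<in> L \<Longrightarrow> 0 < d \<Longrightarrow> d \<le> e h \<Longrightarrow> 0 \<le> h (x + d *\<^sub>R (x - v))"
    by metis
  \<comment> \<open>Inserting 1 keeps the minimum meaningful when \<open>L\<close> is empty.\<close>
  define m where "m = Min (insert 1 (e ` L))"
  have "m > 0" using e(1) finite_L by (auto simp: m_def)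
  moreover have "m \<le> e h" if "h \<in> L" for h using that finite_L by (auto simp: m_def)
  ultimately show ?thesis using that[of m] e(2) by (auto simp: hpoly_def)
qed

lemma zeros_Q_face: "J \<subseteq> L \<Longrightarrow> zeros Q J face_of Q"
proof -
  assume J: "J \<subseteq> L"
  have "a \<in> zeros Q J \<and> b \<in> zeros Q J"
    if ab: "a \<in> Q" "b \<in> Q" "x \<in> zeros Q J" "x \<in> open_segment a b" for a b x
  proof -
    obtain t where t: "0 < t" "t < 1" "x = (1 - t) *\<^sub>R a + t *\<^sub>R b"
      using ab(4) by (auto simp: in_segment)
    have "h a = 0 \<and> h b = 0" if "h \<in> J" for h
    proof -
      have "h x = (1 - t) * h a + t * h b" "h x = 0"
        using affine_fun_comb[OF affine_L, of h "1-t" t] J that ab(3) t by (auto simp: zeros_def)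
      moreover have "h a \<ge> 0" "h b \<ge> 0" using ab J that by (auto simp: hpoly_def)
      moreover have "(1 - t) * h a \<ge> 0" "t * h b \<ge> 0" using calculation t by simp_all
      ultimately have "(1 - t) * h a = 0" "t * h b = 0" by linarith+
      then show ?thesis using t by simp
    qed
    then show ?thesis using ab by (auto simp: zeros_def)
  qed
  moreover have "convex (zeros Q J)"
  proof -
    have "(s *\<^sub>R x + t *\<^sub>R y) \<in> zeros Q J"
      if "x \<in> zeros Q J" "y \<in> zeros Q J" "0 \<le> s" "0 \<le> t" "s + t = 1" for x y s t
    proof -
      have "h (s *\<^sub>R x + t *\<^sub>R y) = 0" if "h \<in> J" for h
      proof -
        have "h x = 0" "h y = 0"
          using that \<open>x \<in> zeros Q J\<close> \<open>y \<in> zeros Q J\<close> by (auto simp: zeros_def)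
        then show ?thesis
          using affine_fun_comb[OF affine_L, of h s t x y] subsetD[OF J that] \<open>s + t = 1\<close> by simp
      qed
      then show ?thesis using that convexD[OF convex_Q, of x y s t] by (auto simp: zeros_def)
    qed
    then show ?thesis by (simp add: convex_def)
  qed
  moreover have "zeros Q J \<subseteq> Q" by (auto simp: zeros_def)
  ultimately show ?thesis unfolding face_of_def by blast
qed

text \<open>The dominating vertex \<open>v\<close> lies on every constraint tight at
  \<open>x\<close>, so the segment from \<open>v\<close> can be prolonged through \<open>x\<close>;
  an extreme \<open>x\<close> must equal \<open>v\<close>.\<close>

lemma extreme_in_V: "x extreme_point_of Q \<Longrightarrow> x \<in> V"
proof -
  assume x: "x extreme_point_of Q"
  then have xQ: "x \<in> Q" by (simp add: extreme_point_of_def)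
  obtain v where v: "v \<in> V" "\<And>h. h \<in> L \<Longrightarrow> h x = 0 \<Longrightarrow> h v = 0" using dominated[OF xQ] by blast
  have vQ: "v \<in> Q" using v V_subset_Q by blast
  obtain e where e: "e > 0" "x + e *\<^sub>R (x - v) \<in> Q"
    using extend_beyond[OF xQ vQ] v(2) by metis
  have "x = v"
    using between_extension[OF e(1)] e(2) x v(1) V_subset_Q
    unfolding extreme_point_of_def by blast
  then show ?thesis using v by simp
qed

text \<open>An extreme point of a face is an extreme point of \<open>Q\<close>, hence listed, and
  Minkowski's theorem recovers the face from its listed points.\<close>

lemma zeros_Q_hull: "J \<subseteq> L \<Longrightarrow> zeros Q J = convex hull (zeros V J)"
proof
  assume J: "J \<subseteq> L"
  note f = zeros_Q_face[OF J]
  have "zeros Q J = convex hull {x. x extreme_point_of zeros Q J}"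
    using face_of_imp_compact[OF convex_Q compact_Q f] face_of_imp_convex[OF f]
    by (rule Krein_Milman_Minkowski)
  moreover have "{x. x extreme_point_of zeros Q J} \<subseteq> zeros V J"
  proof
    fix x assume "x \<in> {x. x extreme_point_of zeros Q J}"
    then have "x \<in> zeros Q J" "x extreme_point_of Q"
      using extreme_point_of_face[OF f] by auto
    then show "x \<in> zeros V J" using extreme_in_V by (auto simp: zeros_def)
  qed
  ultimately show "zeros Q J \<subseteq> convex hull (zeros V J)" using hull_mono by metis
  show "convex hull (zeros V J) \<subseteq> zeros Q J"
    using face_of_imp_convex[OF f] V_subset_Q by (intro hull_minimal) (auto simp: zeros_def)
qed

text \<open>Take a relative interior point \<open>x\<close> of \<open>F\<close> and the constraints
  tight at it. The face cut out by these meets the relative interior of \<open>F\<close>, so it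
  contains \<open>F\<close>; conversely, from each of its points a segment can be prolonged through
  \<open>x\<close>, so the point lies in \<open>F\<close>.\<close>

lemma face_eq_zeros:
  assumes F: "F face_of Q" "F \<noteq> {}"
  obtains J where "J \<subseteq> L" "F = zeros Q J"
proof -
  have cF: "convex F" using F(1) by (rule face_of_imp_convex)
  then obtain x where x: "x \<in> rel_interior F" using F(2) rel_interior_eq_empty by blast
  then have xF: "x \<in> F" using rel_interior_subset by blast
  then have xQ: "x \<in> Q" using F(1) face_of_imp_subset by blast
  define J where "J = {h \<in> L. h x = 0}"
  have J: "J \<subseteq> L" by (auto simp: J_def)
  have "F \<subseteq> zeros Q J"
    using subset_of_face_of[OF zeros_Q_face[OF J], of F] F(1) x xQ face_of_imp_subset
    by (auto simp: zeros_def J_def)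
  moreover have "zeros Q J \<subseteq> F"
  proof
    fix y assume y: "y \<in> zeros Q J"
    then obtain e where e: "e > 0" "x + e *\<^sub>R (x - y) \<in> Q"
      using extend_beyond[OF xQ, of y] by (auto simp: zeros_def J_def)
    show "y \<in> F"
      using between_extension[OF e(1)] e(2) xF F(1) y
      unfolding face_of_def by (metis (no_types, lifting) mem_Collect_eq zeros_def)
  qed
  ultimately show ?thesis using that J by blast
qed

lemma vertex_face: "v \<in> V \<Longrightarrow> {v} face_of Q"
proof -
  assume v: "v \<in> V"
  let ?J = "{h \<in> L. h v = 0}"
  have "zeros V ?J = {v}" using v vertex_unique[OF v] by (auto simp: zeros_def)
  then show ?thesis using zeros_Q_face[of ?J] zeros_Q_hull[of ?J] by auto
qed

lemma zeros_V_eq: "zeros V J = V \<inter> zeros Q J"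
  using V_subset_Q by (auto simp: zeros_def)

lemma polytope_Q: "polytope Q"
proof -
  have "Q = convex hull V" using zeros_Q_hull[of "{}"] by (auto simp: zeros_def)
  then show ?thesis using finite_V unfolding polytope_def by blast
qed

lemma faces_dim_0: "faces_dim 0 Q = (\<lambda>v. {v}) ` V"
proof
  show "(\<lambda>v. {v}) ` V \<subseteq> faces_dim 0 Q" using vertex_face by (auto simp: faces_dim_def)
  show "faces_dim 0 Q \<subseteq> (\<lambda>v. {v}) ` V"
  proof
    fix F assume "F \<in> faces_dim 0 Q"
    then obtain a where a: "F = {a}" "{a} face_of Q" by (auto simp: faces_dim_def aff_dim_eq_0)
    then have "a \<in> V" using extreme_in_V face_of_singleton by blast
    then show "F \<in> (\<lambda>v. {v}) ` V" using a by auto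
  qed
qed

text \<open>Of three collinear points one lies strictly between the others, which a vertex cannot.
  Hence a face of dimension 1 has just two listed vertices.\<close>

lemma no_three_collinear:
  assumes "S \<subseteq> V" "aff_dim S \<le> 1"
  shows "card S \<le> 2"
proof (rule ccontr)
  assume "\<not> card S \<le> 2"
  then have "3 \<le> card S" by simp
  then obtain T where T: "T \<subseteq> S" "card T = 3" by (metis obtain_subset_with_card_n)
  then obtain a b c where abc: "T = {a, b, c}" "a \<noteq> b" "b \<noteq> c" "a \<noteq> c"
    by (auto simp: card_3_iff)
  have "aff_dim T \<le> 1" using aff_dim_subset[OF T(1)] assms(2) by simp
  then have "collinear {a, b, c}" using abc by (simp add: collinear_aff_dim)
  then have "between (b,c) a \<or> between (c,a) b \<or> between (a,b) c"
    by (simp add: collinear_between_cases)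
  moreover have False if "between (q,r) p" "p \<in> V" "q \<in> V" "r \<in> V" "p \<noteq> q" "p \<noteq> r" for p q r
  proof -
    have "p \<in> open_segment q r" using that by (auto simp: between_mem_segment open_segment_def)
    then show False using vertex_face[OF that(2)] that V_subset_Q unfolding face_of_def by blast
  qed
  moreover have "a \<in> V" "b \<in> V" "c \<in> V" using abc T assms by auto
  ultimately show False using abc by metis
qed

lemma faces_dim_1: "faces_dim 1 Q = (\<lambda>E. convex hull E) ` edge_set V L"
proof
  show "(\<lambda>E. convex hull E) ` edge_set V L \<subseteq> faces_dim 1 Q"
  proof
    fix F assume "F \<in> (\<lambda>E. convex hull E) ` edge_set V L"
    then obtain u v where uv: "edge_pair V L u v" "F = convex hull {u, v}"
      by (auto simp: edge_set_def)
    let ?J = "{h \<in> L. h u = 0 \<and> h v = 0}"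
    have "zeros V ?J = {u, v}" using uv(1) by (auto simp: zeros_def edge_pair_def)
    then have "F face_of Q" using zeros_Q_face[of ?J] zeros_Q_hull[of ?J] uv(2) by auto
    moreover have "aff_dim F = 1"
      using uv by (simp only: edge_pair_def aff_dim_convex_hull aff_dim_2) simp
    ultimately show "F \<in> faces_dim 1 Q" by (simp add: faces_dim_def)
  qed
  show "faces_dim 1 Q \<subseteq> (\<lambda>E. convex hull E) ` edge_set V L"
  proof
    fix F assume "F \<in> faces_dim 1 Q"
    then have F: "F face_of Q" "aff_dim F = 1" by (auto simp: faces_dim_def)
    then have "F \<noteq> {}" by auto
    with F obtain J where J: "J \<subseteq> L" "F = zeros Q J" by (metis face_eq_zeros)
    have Fh: "F = convex hull (zeros V J)" using J zeros_Q_hull by simp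
    then have ad: "aff_dim (zeros V J) = 1" using F aff_dim_convex_hull[of "zeros V J"] by simp
    have fin: "finite (zeros V J)" using finite_V zeros_subset finite_subset by blast
    have "card (zeros V J) \<le> 2" using no_three_collinear[OF zeros_subset] ad by simp
    moreover have "int (card (zeros V J)) \<ge> 2" using aff_dim_le_card[OF fin] ad by simp
    ultimately have "card (zeros V J) = 2" by simp
    then obtain u v where uv: "zeros V J = {u, v}" "u \<noteq> v" by (auto simp: card_2_iff)
    have "edge_pair V L u v" unfolding edge_pair_def
    proof (intro conjI ballI impI)
      show "u \<in> V" "v \<in> V" "u \<noteq> v" using uv zeros_subset by blast+
      fix w assume w: "w \<in> V" "\<forall>h\<in>L. h u = 0 \<longrightarrow> h v = 0 \<longrightarrow> h w = 0"
      have "u \<in> zeros V J" "v \<in> zeros V J" using uv by auto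
      then have "w \<in> zeros V J" using w J(1) by (auto simp: zeros_def)
      then show "w = u \<or> w = v" using uv by auto
    qed
    then show "F \<in> (\<lambda>E. convex hull E) ` edge_set V L" using Fh uv by (auto simp: edge_set_def)
  qed
qed

lemma fnum_0: "fnum 0 Q = card V"
  unfolding fnum_def faces_dim_0 by (rule card_image) (auto simp: inj_on_def)

lemma fnum_1: "fnum 1 Q = card (edge_set V L)"
proof -
  have "inj_on ((hull) convex) (edge_set V L)"
  proof (rule inj_onI)
    fix E F :: "'a set" assume EF: "E \<in> edge_set V L" "F \<in> edge_set V L" "convex hull E = convex hull F"
    from EF(1) obtain a b where E: "E = {a, b}" unfolding edge_set_def mem_Collect_eq by metis
    from EF(2) obtain c d where F: "F = {c, d}" unfolding edge_set_def mem_Collect_eq by metis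
    have "closed_segment a b = closed_segment c d"
      using EF(3) unfolding E F segment_convex_hull .
    then show "E = F" unfolding E F closed_segment_eq .
  qed
  then show ?thesis unfolding fnum_def faces_dim_1 by (rule card_image)
qed

end

text \<open>\<open>facets_meet\<close> makes all 2-faces triangles, since a 2-face lies on at least
  two facets. \<open>facet_dim\<close> asks only for a lower bound, which survives the addition of
  vertices; that the dimension is exactly 3 follows from \<open>facet_proper\<close>.
  \<open>edge_count\<close> is f_1 = 4 f_0 - 10.\<close>

locale two_two_polytope = vh_polytope V L
  for V :: "(real^4) set" and L :: "(real^4 \<Rightarrow> real) set" +
  assumes two_facets: "\<exists>h\<in>L. \<exists>h'\<in>L. h \<noteq> h'"
    and facets_meet: "h \<in> L \<Longrightarrow> h' \<in> L \<Longrightarrow> h \<noteq> h' \<Longrightarrow> card {v \<in> V. h v = 0 \<and> h' v = 0} \<le> 3"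
    and facet_dim: "h \<in> L \<Longrightarrow> 3 \<le> aff_dim {v \<in> V. h v = 0}"
    and edge_degree: "edge_pair V L u v \<Longrightarrow> card {h \<in> L. h u = 0 \<and> h v = 0} = 3"
    and edge_count: "card (edge_set V L) + 10 = 4 * card V"
begin

lemma finite_zeros: "finite (zeros V J)"
  using finite_V zeros_subset finite_subset by blast

lemma zeros_two_facets:
  assumes "h \<in> J" "h' \<in> J" "h \<noteq> h'" "J \<subseteq> L"
  shows "card (zeros V J) \<le> 3"
proof -
  have "card (zeros V J) \<le> card {v \<in> V. h v = 0 \<and> h' v = 0}"
    using assms finite_V by (intro card_mono) (auto simp: zeros_def)
  also have "\<dots> \<le> 3" using assms by (intro facets_meet) auto
  finally show ?thesis .
qed

lemma facet_aff_dim_lower: "h \<in> L \<Longrightarrow> 3 \<le> aff_dim (zeros V {h})"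
  using facet_dim[of h] by (simp add: zeros_def)

lemma facet_card_lower: "h \<in> L \<Longrightarrow> 4 \<le> card (zeros V {h})"
  using facet_aff_dim_lower[of h] aff_dim_le_card[OF finite_zeros[of "{h}"]] by linarith

text \<open>If \<open>h\<close> vanished on all vertices, every vertex of another facet would be
  common to both, so that facet would have at most three vertices; but a facet has at least
  four.\<close>

lemma facet_proper:
  assumes "h \<in> L"
  obtains v where "v \<in> V" "h v \<noteq> 0"
proof -
  obtain h' where h': "h' \<in> L" "h' \<noteq> h" using two_facets by metis
  have "\<not> zeros V {h'} \<subseteq> zeros V {h, h'}"
    using zeros_two_facets[of h "{h,h'}" h'] facet_card_lower[OF h'(1)] h' assms
      card_mono[OF finite_zeros[of "{h,h'}"], of "zeros V {h'}"] by auto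
  then show ?thesis using that by (auto simp: zeros_def)
qed

lemma aff_dim_V: "aff_dim V = 4"
proof -
  obtain h where h: "h \<in> L" using two_facets by blast
  obtain v where v: "v \<in> V" "h v \<noteq> 0" using facet_proper[OF h] .
  have "v \<notin> affine hull (zeros V {h})"
    using affine_fun_zero_affine_hull[OF affine_L[OF h], of "zeros V {h}"] v by (auto simp: zeros_def)
  then have "4 \<le> aff_dim (insert v (zeros V {h}))"
    using facet_aff_dim_lower[OF h] by (simp add: aff_dim_insert)
  also have "\<dots> \<le> aff_dim V" using v zeros_subset by (intro aff_dim_subset) auto
  finally show ?thesis using aff_dim_le_DIM[of V] by simp
qed

lemma aff_dim_Q: "aff_dim Q = 4"
proof -
  have "Q = convex hull V" using zeros_Q_hull[of "{}"] by (auto simp: zeros_def)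
  then show ?thesis using aff_dim_V by (simp add: aff_dim_convex_hull)
qed

lemma aff_dim_facet: "h \<in> L \<Longrightarrow> aff_dim (zeros Q {h}) = 3"
proof -
  assume h: "h \<in> L"
  obtain v where v: "v \<in> V" "h v \<noteq> 0" using facet_proper[OF h] .
  have "zeros Q {h} face_of Q" using h by (intro zeros_Q_face) auto
  moreover have "zeros Q {h} \<noteq> Q" using v V_subset_Q by (auto simp: zeros_def)
  ultimately have "aff_dim (zeros Q {h}) < 4"
    using face_of_aff_dim_lt[OF convex_Q] aff_dim_Q by auto
  moreover have "3 \<le> aff_dim (zeros Q {h})"
    using facet_aff_dim_lower[OF h] zeros_Q_hull[of "{h}"] h by (simp add: aff_dim_convex_hull)
  ultimately show ?thesis by simp
qed

text \<open>At most three vertices span dimension at most 2, so the cases separate \<open>Q\<close>,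
  its facets and all smaller faces.\<close>

lemma zeros_cases:
  assumes "J \<subseteq> L"
  shows "J = {} \<or> (\<exists>h\<in>L. J = {h}) \<or> card (zeros V J) \<le> 3"
  using zeros_two_facets[of _ J] assms by blast

lemma faces_dim_3: "faces_dim 3 Q = (\<lambda>h. zeros Q {h}) ` L"
proof
  show "(\<lambda>h. zeros Q {h}) ` L \<subseteq> faces_dim 3 Q"
    using zeros_Q_face aff_dim_facet by (auto simp: faces_dim_def)
  show "faces_dim 3 Q \<subseteq> (\<lambda>h. zeros Q {h}) ` L"
  proof
    fix F assume "F \<in> faces_dim 3 Q"
    then have F: "F face_of Q" "aff_dim F = 3" by (auto simp: faces_dim_def)
    then have "F \<noteq> {}" by auto
    with F obtain J where J: "J \<subseteq> L" "F = zeros Q J" by (metis face_eq_zeros)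
    have "J \<noteq> {}" using F J aff_dim_Q by (auto simp: zeros_def)
    moreover have "\<not> card (zeros V J) \<le> 3"
      using aff_dim_le_card[OF finite_zeros[of J]] F J zeros_Q_hull[OF J(1)] by (simp add: aff_dim_convex_hull)
    ultimately show "F \<in> (\<lambda>h. zeros Q {h}) ` L" using zeros_cases[OF J(1)] J(2) by auto
  qed
qed

text \<open>Lets facets be counted by functionals: two functionals with the same zero set would
  share at least four vertices.\<close>

lemma inj_facets: "inj_on (\<lambda>h. zeros Q {h}) L"
proof (rule inj_onI, rule ccontr)
  fix h h' assume h: "h \<in> L" "h' \<in> L" "zeros Q {h} = zeros Q {h'}" "h \<noteq> h'"
  then have "zeros V {h} = zeros V {h'}" by (simp add: zeros_V_eq)
  then have "zeros V {h} = zeros V {h, h'}" by (auto simp: zeros_def)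
  then show False using zeros_two_facets[of h "{h,h'}" h'] facet_card_lower[OF h(1)] h by auto
qed

lemma two_face:
  assumes "F \<in> faces_dim 2 Q"
  shows "card (V \<inter> F) = 3 \<and> F = convex hull (V \<inter> F) \<and> aff_dim (V \<inter> F) = 2"
proof -
  have F: "F face_of Q" "aff_dim F = 2" using assms by (auto simp: faces_dim_def)
  then have "F \<noteq> {}" by auto
  with F obtain J where J: "J \<subseteq> L" "F = zeros Q J" by (metis face_eq_zeros)
  have VF: "V \<inter> F = zeros V J" using J zeros_V_eq by simp
  have ad: "aff_dim (zeros V J) = 2" using F J zeros_Q_hull[OF J(1)] by (simp add: aff_dim_convex_hull)
  have "J \<noteq> {}" using F J aff_dim_Q by (auto simp: zeros_def)
  moreover have "J \<noteq> {h}" if "h \<in> L" for h using F J aff_dim_facet[OF that] by auto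
  ultimately have "card (zeros V J) \<le> 3" using zeros_cases[OF J(1)] by auto
  moreover have "3 \<le> card (zeros V J)" using aff_dim_le_card[OF finite_zeros[of J]] ad by simp
  ultimately show ?thesis using VF ad J zeros_Q_hull[OF J(1)] by simp
qed

lemma two_simplicial_Q: "two_simplicial Q"
  unfolding two_simplicial_def
proof
  fix F assume "F \<in> faces_dim 2 Q"
  note F = two_face[OF this]
  have "\<not> affine_dependent (V \<inter> F)"
    using F finite_V by (simp add: affine_independent_iff_card)
  then show "2 simplex F" using F unfolding simplex_def by (intro exI[of _ "V \<inter> F"]) auto
qed

lemma two_simple4_Q: "two_simple4 Q"
  unfolding two_simple4_def
proof
  fix E assume "E \<in> faces_dim 1 Q"
  then obtain u v where uv: "edge_pair V L u v" "E = convex hull {u, v}"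
    by (auto simp: faces_dim_1 edge_set_def)
  have sub: "E \<subseteq> zeros Q {h} \<longleftrightarrow> h u = 0 \<and> h v = 0" if h: "h \<in> L" for h
  proof
    assume "E \<subseteq> zeros Q {h}"
    moreover have "u \<in> E" "v \<in> E" using uv(2) by (auto intro: hull_inc)
    ultimately show "h u = 0 \<and> h v = 0" by (auto simp: zeros_def)
  next
    assume "h u = 0 \<and> h v = 0"
    then have "{u, v} \<subseteq> zeros Q {h}"
      using uv(1) V_subset_Q by (auto simp: zeros_def edge_pair_def)
    moreover have "convex (zeros Q {h})" using zeros_Q_face[of "{h}"] h face_of_imp_convex by auto
    ultimately show "E \<subseteq> zeros Q {h}" using uv(2) by (simp add: hull_minimal)
  qed
  have "{G \<in> faces_dim 3 Q. E \<subseteq> G} = (\<lambda>h. zeros Q {h}) ` {h \<in> L. h u = 0 \<and> h v = 0}"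
    unfolding faces_dim_3 using sub by blast
  moreover have "inj_on (\<lambda>h. zeros Q {h}) {h \<in> L. h u = 0 \<and> h v = 0}"
    using inj_facets by (rule inj_on_subset) auto
  ultimately show "card {G \<in> faces_dim 3 Q. E \<subseteq> G} = 3"
    using edge_degree[OF uv(1)] by (simp add: card_image)
qed

text \<open>Counted by 2-faces, each with three vertices. The first two terms of \<open>g2\<close>
  then cancel and leave f_1 - 4 f_0 + 10.\<close>

lemma f02_Q: "f02 Q = 3 * fnum 2 Q"
proof -
  have fin: "finite (faces_dim 2 Q)"
    using finite_polytope_faces[OF polytope_Q] by (rule finite_subset[rotated]) (auto simp: faces_dim_def)
  have "{(v, F). {v} \<in> faces_dim 0 Q \<and> F \<in> faces_dim 2 Q \<and> v \<in> F}
      = prod.swap ` (SIGMA F:faces_dim 2 Q. V \<inter> F)"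
    by (auto simp: faces_dim_0 image_iff)
  then have "f02 Q = card (SIGMA F:faces_dim 2 Q. V \<inter> F)"
    unfolding f02_def by (simp add: card_image)
  also have "\<dots> = (\<Sum>F\<in>faces_dim 2 Q. card (V \<inter> F))"
    using fin finite_V by (intro card_SigmaI) auto
  also have "\<dots> = (\<Sum>F\<in>faces_dim 2 Q. 3)" using two_face by (intro sum.cong) auto
  finally show ?thesis by (simp add: fnum_def)
qed

lemma elementary_Q: "elementary 4 Q"
proof -
  have "int (card (edge_set V L)) + 10 = 4 * int (card V)" using edge_count by linarith
  then show ?thesis
    by (simp add: elementary_def g2_def f02_Q fnum_0 fnum_1 choose_two)
qed

lemma realizes:
  "polytope Q \<and> aff_dim Q = 4 \<and> fnum 0 Q = card V \<and> two_simple4 Q \<and> two_simplicial Q \<and> elementary 4 Q"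
  using polytope_Q aff_dim_Q fnum_0 two_simple4_Q two_simplicial_Q elementary_Q by simp

end

section \<open>Gluing\<close>

abbreviation coord :: "4 \<Rightarrow> real^4 \<Rightarrow> real" where
  "coord i \<equiv> \<lambda>x. x $ i"

abbreviation unit :: "4 \<Rightarrow> real^4" where
  "unit i \<equiv> axis i 1"

definition csum :: "real^4 \<Rightarrow> real" where
  "csum x = (\<Sum>i\<in>UNIV. x $ i)"

lemma unit_nth: "unit i $ j = (if i = j then 1 else 0)"
  by (simp add: axis_def)

lemma csum_unit [simp]: "csum (unit i) = 1"
  by (simp add: csum_def axis_def)

lemma csum_0 [simp]: "csum 0 = 0"
  by (simp add: csum_def)

lemma unit_eq_iff [simp]: "unit i = unit j \<longleftrightarrow> i = j"
  by (simp add: axis_eq_axis)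

lemma unit_neq_0 [simp]: "unit i \<noteq> 0"
  by (simp add: axis_eq_0_iff)

lemma card_units: "card (range unit) = 4"
  by (subst card_image) (auto simp: inj_on_def)

lemma coord_inj: "coord i = coord j \<longleftrightarrow> i = j"
  by (metis unit_nth zero_neq_one)

text \<open>\<open>1 - csum x\<close> and the coordinates of \<open>x\<close> are its barycentric
  coordinates with respect to 0 and the unit vectors.\<close>

lemma affine_fun_expand:
  assumes "affine_fun h"
  shows "h x = (1 - csum x) * h 0 + (\<Sum>i\<in>UNIV. x $ i * h (unit i))"
proof -
  obtain a b where h: "\<And>x. h x = a \<bullet> x + b"
    using assms unfolding affine_fun_def by blast
  have "h x = (\<Sum>i\<in>UNIV. a $ i * x $ i) + b" by (simp add: h inner_vec_def)
  moreover have "h (unit i) = a $ i + b" for i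
    by (simp add: h inner_axis)
  moreover have "(\<Sum>i\<in>UNIV. x $ i * (a $ i + b)) = (\<Sum>i\<in>UNIV. a $ i * x $ i) + csum x * b"
    by (simp add: csum_def algebra_simps sum.distrib sum_distrib_left)
  ultimately show ?thesis by (simp add: h algebra_simps)
qed

text \<open>The last premise has two readings: \<open>h 0\<close> positive and \<open>x\<close>
  before the hyperplane \<open>csum x = 1\<close>, or \<open>h 0\<close> negative and
  \<open>x\<close> beyond it. They become \<open>outer_pos\<close> and
  \<open>inner_pos\<close>.\<close>

lemma affine_fun_pos:
  assumes h: "affine_fun h" "\<And>i. 0 \<le> h (unit i)" and x: "\<And>i. 0 \<le> x $ i"
    and s: "0 < (1 - csum x) * h 0"
  shows "0 < h x"
  using affine_fun_expand[OF h(1), of x] s sum_nonneg[of UNIV "\<lambda>i. x $ i * h (unit i)"] h(2) x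
  by simp

lemma csum_pos_ex:
  assumes "0 < csum x"
  obtains m where "x $ m \<noteq> 0"
proof -
  have "\<exists>m. x $ m \<noteq> 0"
  proof (rule ccontr)
    assume "\<nexists>m. x $ m \<noteq> 0"
    then have "csum x = 0" by (simp add: csum_def)
    then show False using assms by simp
  qed
  then show ?thesis using that by blast
qed

text \<open>If a single coordinate hyperplane carries all facets through an edge, then three unit vectors lie
  on all of them, which is too many for an edge.\<close>
lemma edge_not_only_coord:
  assumes "edge_pair V L u v" "\<And>i. unit i \<in> V"
    and "\<And>h. h \<in> L \<Longrightarrow> h u = 0 \<Longrightarrow> h v = 0 \<Longrightarrow> \<exists>i. h = coord i"
    and "\<And>i j. u $ i = 0 \<Longrightarrow> v $ i = 0 \<Longrightarrow> u $ j = 0 \<Longrightarrow> v $ j = 0 \<Longrightarrow> i = j"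
  shows False
proof -
  let ?Z = "{m. u $ m = 0 \<and> v $ m = 0}"
  have "card ?Z \<le> 1"
    using assms(4) by (intro card_le_Suc0_iff_eq[THEN iffD2, simplified One_nat_def[symmetric]]) auto
  moreover have "card (- ?Z) = 4 - card ?Z" by (simp add: Compl_eq_Diff_UNIV card_Diff_subset)
  ultimately have 3: "3 \<le> card (- ?Z)" by simp
  have "unit ` (- ?Z) \<subseteq> {u, v}"
  proof
    fix w assume "w \<in> unit ` (- ?Z)"
    then obtain m where m: "w = unit m" "u $ m \<noteq> 0 \<or> v $ m \<noteq> 0" by auto
    have "h w = 0" if h: "h \<in> L" "h u = 0" "h v = 0" for h
    proof -
      obtain i where i: "h = coord i" using assms(3) h by blast
      then have "i \<noteq> m" using m h by auto
      then show ?thesis using i m by (simp add: unit_nth)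
    qed
    then show "w \<in> {u, v}" using assms(1,2) m unfolding edge_pair_def by blast
  qed
  then have "card (unit ` (- ?Z)) \<le> card {u, v}" by (intro card_mono) auto
  moreover have "card (unit ` (- ?Z)) = card (- ?Z)" by (intro card_image) (auto simp: inj_on_def)
  moreover have "card {u, v} \<le> 2" by (simp add: card_insert_if)
  ultimately show False using 3 by linarith
qed

text \<open>The origin is a simple vertex with the unit vectors as neighbours, and the 2-faces at the origin
  are triangles (\<open>far_zero\<close>).\<close>
locale framed_polytope = two_two_polytope +
  assumes coord_in: "coord i \<in> L"
    and origin_in: "0 \<in> V"
    and unit_in: "unit i \<in> V"
    and far: "v \<in> V \<Longrightarrow> v \<noteq> 0 \<Longrightarrow> (\<And>i. v \<noteq> unit i) \<Longrightarrow> 1 < csum v"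
    and far_zero: "v \<in> V \<Longrightarrow> 1 < csum v \<Longrightarrow> v $ i = 0 \<Longrightarrow> v $ j = 0 \<Longrightarrow> i = j"
    and noncoord: "h \<in> L \<Longrightarrow> (\<And>i. h \<noteq> coord i) \<Longrightarrow> 0 < h 0"
    and cap: "i \<noteq> j \<Longrightarrow> \<exists>h\<in>L. 0 < h 0 \<and> h (unit i) = 0 \<and> h (unit j) = 0"

text \<open>A polytope inside the standard simplex that shares with it the facet \<open>csum x = 1\<close> and whose four
  neighbouring facets lie in the coordinate hyperplanes. It can replace the corner of a framed polytope
  at the origin; all its other facets cut off the origin.\<close>
locale gadget = two_two_polytope +
  assumes coord_in: "coord i \<in> L"
    and base_in: "(\<lambda>x. 1 - csum x) \<in> L"
    and unit_in: "unit i \<in> V"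
    and near: "v \<in> V \<Longrightarrow> (\<And>i. v \<noteq> unit i) \<Longrightarrow> csum v < 1"
    and noncoord: "h \<in> L \<Longrightarrow> (\<And>i. h \<noteq> coord i) \<Longrightarrow> h \<noteq> (\<lambda>x. 1 - csum x) \<Longrightarrow> h 0 < 0"

definition glue_V :: "(real^4) set \<Rightarrow> (real^4) set \<Rightarrow> (real^4) set" where
  "glue_V VP VR = {v \<in> VP. csum v < 1} \<union> (VR - {0})"

text \<open>Removal comes before the union on purpose: if \<open>R\<close> is the standard simplex,
  \<open>1 - csum x\<close> is a facet of \<open>R\<close> as well and stays, and gluing gives back
  \<open>P\<close>.\<close>

definition glue_L :: "(real^4 \<Rightarrow> real) set \<Rightarrow> (real^4 \<Rightarrow> real) set \<Rightarrow> (real^4 \<Rightarrow> real) set" where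
  "glue_L LP LR = (LP - {\<lambda>x. 1 - csum x}) \<union> LR"

locale gluing = P: gadget VP LP + R: framed_polytope VR LR for VP LP VR LR
begin

abbreviation "A \<equiv> {v \<in> VP. csum v < 1}"
abbreviation "B \<equiv> VR - {0}"
abbreviation "VS \<equiv> glue_V VP VR"
abbreviation "LS \<equiv> glue_L LP LR"

section \<open>Vertices and facets on the two sides of the gluing hyperplane\<close>

lemma VS_cases:
  assumes "v \<in> VS"
  obtains "v \<in> A" | "v \<in> B"
  using assms by (auto simp: glue_V_def)

lemma B_cases:
  assumes "v \<in> B"
  obtains i where "v = unit i" | "1 < csum v" "\<And>i j. v $ i = 0 \<Longrightarrow> v $ j = 0 \<Longrightarrow> i = j"
  using assms R.far R.far_zero by (metis DiffE singletonI)

lemma VP_cases: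
  assumes "v \<in> VP"
  obtains i where "v = unit i" | "v \<in> A"
  using assms P.near by blast

lemma unit_B: "unit i \<in> B" using R.unit_in by simp

lemma unit_VS: "unit i \<in> VS" using unit_B by (simp add: glue_V_def)

lemma A_VS: "v \<in> A \<Longrightarrow> v \<in> VS" by (simp add: glue_V_def)
lemma B_VS: "v \<in> B \<Longrightarrow> v \<in> VS" by (simp add: glue_V_def)

lemma VP_VS: "v \<in> VP \<Longrightarrow> v \<in> VS"
  using VP_cases A_VS unit_VS by metis

lemma B_csum: "v \<in> B \<Longrightarrow> 1 \<le> csum v"
  by (elim B_cases) auto

lemma A_B_disjoint: "A \<inter> B = {}"
  using B_csum by fastforce

lemma A_nonneg: "v \<in> VP \<Longrightarrow> 0 \<le> v $ i"
  using P.V_nonneg[OF _ P.coord_in] by simp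
lemma B_nonneg: "v \<in> VR \<Longrightarrow> 0 \<le> v $ i"
  using R.V_nonneg[OF _ R.coord_in] by simp

text \<open>The cases are the sign zero, negative and positive of \<open>h 0\<close>: facets through
  the removed corner, inner facets from \<open>P\<close>, outer facets from
  \<open>R\<close>.\<close>

lemma LS_cases:
  assumes "h \<in> LS"
  obtains i where "h = coord i" | "h \<in> LP" "h 0 < 0" | "h \<in> LR" "0 < h 0"
  using assms P.noncoord R.noncoord unfolding glue_L_def by blast

lemma LR_LS: "h \<in> LR \<Longrightarrow> h \<in> LS" by (simp add: glue_L_def)

lemma inner_LS: "h \<in> LP \<Longrightarrow> h 0 < 0 \<Longrightarrow> h \<in> LS" by (auto simp: glue_L_def)

lemma coord_LS: "coord i \<in> LS" using R.coord_in by (simp add: glue_L_def)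

lemma LP_LS: "h \<in> LP \<Longrightarrow> csum v < 1 \<Longrightarrow> h v = 0 \<Longrightarrow> h \<in> LS" by (auto simp: glue_L_def)

lemma LS_affine: "h \<in> LS \<Longrightarrow> affine_fun h"
  using P.affine_L R.affine_L by (auto simp: glue_L_def)

text \<open>An inner facet cannot touch the orthant beyond \<open>csum x = 1\<close>: the weight
  \<open>1 - csum x\<close> and the value \<open>h 0\<close> are both negative, and the unit vectors
  contribute nonnegative terms.\<close>

lemma inner_pos:
  assumes "h \<in> LP" "h 0 < 0" "\<And>i. 0 \<le> x $ i" "1 < csum x"
  shows "0 < h x"
  using affine_fun_pos[OF P.affine_L[OF assms(1)] P.V_nonneg[OF P.unit_in assms(1)] assms(3)]
    assms(2,4) by (simp add: mult_neg_neg)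

lemma outer_pos:
  assumes "h \<in> LR" "0 < h 0" "\<And>i. 0 \<le> x $ i" "csum x < 1"
  shows "0 < h x"
  using affine_fun_pos[OF R.affine_L[OF assms(1)] R.V_nonneg[OF R.unit_in assms(1)] assms(3)]
    assms(2,4) by simp

lemma edge_units_P: "i \<noteq> j \<Longrightarrow> edge_pair VP LP (unit i) (unit j)"
  unfolding edge_pair_def
proof (intro conjI ballI impI)
  assume ij: "i \<noteq> j"
  show "unit i \<in> VP" "unit j \<in> VP" using P.unit_in by auto
  show "unit i \<noteq> unit j" using ij by simp
  fix w assume w: "w \<in> VP" "\<forall>h\<in>LP. h (unit i) = 0 \<longrightarrow> h (unit j) = 0 \<longrightarrow> h w = 0"
  have "csum w = 1" using bspec[OF w(2) P.base_in] by simp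
  then obtain m where m: "w = unit m" using P.near[OF w(1)] by force
  have "m = i \<or> m = j"
    using bspec[OF w(2) P.coord_in, of m] m by (auto simp: unit_nth split: if_splits)
  then show "w = unit i \<or> w = unit j" using m by auto
qed

text \<open>Two unit vectors span an edge of \<open>P\<close> that already lies on two coordinate
  facets and on the base; an inner facet through both would be a fourth.\<close>

lemma inner_one_unit:
  assumes "h \<in> LP" "h 0 < 0" "h (unit i) = 0" "h (unit j) = 0"
  shows "i = j"
proof (rule ccontr)
  assume ij: "i \<noteq> j"
  obtain k l where kl: "k \<noteq> i" "k \<noteq> j" "l \<noteq> i" "l \<noteq> j" "k \<noteq> l"
  proof -
    have "card (- {i, j}) = 2" using ij by (simp add: Compl_eq_Diff_UNIV card_Diff_subset)
    then show ?thesis using that by (auto simp: card_2_iff)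
  qed
  let ?b = "\<lambda>x. 1 - csum x"
  have "{coord k, coord l, ?b, h} \<subseteq> {h \<in> LP. h (unit i) = 0 \<and> h (unit j) = 0}"
    using kl assms P.coord_in P.base_in by (auto simp: unit_nth)
  from card_mono[OF _ this] have "card {coord k, coord l, ?b, h} \<le> 3"
    using P.edge_degree[OF edge_units_P[OF ij]] P.finite_L by simp
  moreover have "coord k \<noteq> coord l" using kl coord_inj by simp
  moreover have "coord k \<noteq> ?b" "coord l \<noteq> ?b" "coord k \<noteq> h" "coord l \<noteq> h" "?b \<noteq> h"
    using assms(2) by (auto dest: fun_cong[of _ _ 0])
  ultimately show False by simp
qed

lemma zero_on_A: "h \<in> LS \<Longrightarrow> u \<in> A \<Longrightarrow> h u = 0 \<Longrightarrow> h \<in> LP"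
  using outer_pos A_nonneg P.coord_in
  by (elim LS_cases) (metis (no_types, lifting) less_irrefl mem_Collect_eq)+

text \<open>A single vertex of \<open>B\<close> would not do, because a unit vector may lie on an
  inner facet. But an inner facet contains no far vertex and at most one unit vector.\<close>

lemma zero_on_B:
  assumes "h \<in> LS" "u \<in> B" "v \<in> B" "u \<noteq> v" "h u = 0" "h v = 0"
  shows "h \<in> LR"
  using assms(1)
proof (cases rule: LS_cases)
  case (1 i)
  then show ?thesis using R.coord_in by simp
next
  case 2
  have "\<not> 1 < csum u" "\<not> 1 < csum v"
    using inner_pos[OF 2] B_nonneg assms by (metis DiffD1 less_irrefl)+
  then obtain i j where "u = unit i" "v = unit j" using assms B_cases by metis
  then show ?thesis using inner_one_unit[OF 2] assms by blast
next
  case 3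
  then show ?thesis by simp
qed

section \<open>Edges of the glued polytope\<close>

lemma common_A:
  assumes "u \<in> A"
  shows "{h \<in> LS. h u = 0 \<and> h v = 0} = {h \<in> LP. h u = 0 \<and> h v = 0}"
  using assms zero_on_A LP_LS by blast

lemma common_B:
  assumes "u \<in> B" "v \<in> B" "u \<noteq> v"
  shows "{h \<in> LS. h u = 0 \<and> h v = 0} = {h \<in> LR. h u = 0 \<and> h v = 0}"
  using assms zero_on_B LR_LS by blast

text \<open>The facets through \<open>u\<close> and \<open>v\<close> are the same in both polytopes,
  so only a far vertex \<open>w\<close> on all of them could spoil an edge of \<open>P\<close>. An
  outer facet misses \<open>u\<close> and an inner one misses \<open>w\<close>; what remains is at
  most one coordinate facet, because \<open>w\<close> is far, and \<open>edge_not_only_coord\<close>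
  excludes this.\<close>

lemma edge_A:
  assumes u: "u \<in> A" and v: "v \<in> VP"
  shows "edge_pair VS LS u v \<longleftrightarrow> edge_pair VP LP u v"
proof
  assume e: "edge_pair VS LS u v"
  then show "edge_pair VP LP u v"
    using u v VP_VS unfolding edge_pair_common common_A[OF u] by blast
next
  assume e: "edge_pair VP LP u v"
  have "w = u \<or> w = v" if w: "w \<in> VS" "\<forall>h\<in>{h \<in> LP. h u = 0 \<and> h v = 0}. h w = 0" for w
  proof (cases "w \<in> VP")
    case True
    then show ?thesis using e w unfolding edge_pair_common by blast
  next
    case False
    then have B: "w \<in> B" using w VS_cases by blast
    then have far: "1 < csum w" "\<And>i j. w $ i = 0 \<Longrightarrow> w $ j = 0 \<Longrightarrow> i = j"
      using False P.unit_in B_cases by metis+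
    have c: "\<exists>i. h = coord i" if h: "h \<in> LP" "h u = 0" "h v = 0" for h
    proof -
      have "h \<in> LS" using LP_LS h u by blast
      moreover have "h w = 0" using w h by blast
      ultimately show ?thesis
      proof (cases rule: LS_cases)
        case 2
        then show ?thesis using inner_pos[OF 2 B_nonneg far(1)] B \<open>h w = 0\<close> by auto
      next
        case 3
        then show ?thesis using outer_pos[OF 3, of u] A_nonneg u h by auto
      qed auto
    qed
    have False
    proof (rule edge_not_only_coord[OF e P.unit_in c])
      show "i = j" if "u $ i = 0" "v $ i = 0" "u $ j = 0" "v $ j = 0" for i j
        using far(2) w(2) that P.coord_in by auto
    qed
    then show ?thesis ..
  qed
  then show "edge_pair VS LS u v"
    using e VP_VS unfolding edge_pair_common common_A[OF u] by blast
qed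

text \<open>On the near side gluing removes 0 and adds \<open>A\<close>; \<open>w\<close> stands for
  either, and \<open>V\<close>, \<open>L\<close> for the polytope before or after gluing. Since
  outer facets miss \<open>w\<close>, the points \<open>u\<close> and \<open>v\<close> share only
  coordinate facets. For two unit vectors \<open>cap\<close> supplies an outer facet after all;
  otherwise one of them is far and has at most one zero coordinate.\<close>

lemma edge_B_exclude:
  assumes e: "edge_pair V L u v" and V: "\<And>i. unit i \<in> V" and uv: "u \<in> B" "v \<in> B"
    and L: "{h \<in> L. h u = 0 \<and> h v = 0} = {h \<in> LR. h u = 0 \<and> h v = 0}"
    and w: "w = 0 \<or> w \<in> A" "\<forall>h\<in>{h \<in> LR. h u = 0 \<and> h v = 0}. h w = 0"
  shows False
proof -
  have pos: "0 < h w" if "h \<in> LR" "0 < h 0" for h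
    using w(1) that outer_pos[OF that] A_nonneg by auto
  have c: "\<exists>i. h = coord i" if "h \<in> L" "h u = 0" "h v = 0" for h
  proof -
    have h: "h \<in> LR" "h w = 0" using that L w(2) by blast+
    then show ?thesis using pos[of h] R.noncoord[of h] by force
  qed
  show False
  proof (cases "\<exists>i j. u = unit i \<and> v = unit j")
    case True
    then obtain i j where ij: "u = unit i" "v = unit j" by blast
    then have "i \<noteq> j" using e by (auto simp: edge_pair_def)
    then obtain h where "h \<in> LR" "h u = 0" "h v = 0" "0 < h 0" using ij R.cap by blast
    then show False using pos w(2) by fastforce
  next
    case False
    then have "u $ i = 0 \<Longrightarrow> v $ i = 0 \<Longrightarrow> u $ j = 0 \<Longrightarrow> v $ j = 0 \<Longrightarrow> i = j" for i j
      using uv B_cases by metis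
    then show False using edge_not_only_coord[OF e V c] by blast
  qed
qed

lemma edge_B:
  assumes u: "u \<in> B" and v: "v \<in> B"
  shows "edge_pair VS LS u v \<longleftrightarrow> edge_pair VR LR u v"
proof (cases "u = v")
  case True
  then show ?thesis by (simp add: edge_pair_def)
next
  case False
  note c = common_B[OF u v False]
  show ?thesis
  proof
    assume e: "edge_pair VS LS u v"
    have "w = u \<or> w = v" if w: "w \<in> VR" "\<forall>h\<in>{h \<in> LR. h u = 0 \<and> h v = 0}. h w = 0" for w
    proof (cases "w = 0")
      case True
      then show ?thesis using edge_B_exclude[OF e unit_VS u v c _ w(2)] by blast
    next
      case False
      then show ?thesis using e w B_VS unfolding edge_pair_common c by blast
    qed
    then show "edge_pair VR LR u v" using e u v unfolding edge_pair_common by blast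
  next
    assume e: "edge_pair VR LR u v"
    have "w = u \<or> w = v" if w: "w \<in> VS" "\<forall>h\<in>{h \<in> LR. h u = 0 \<and> h v = 0}. h w = 0" for w
      using w(1)
    proof (cases rule: VS_cases)
      case 1
      then show ?thesis using edge_B_exclude[OF e R.unit_in u v refl _ w(2)] by blast
    next
      case 2
      then show ?thesis using e w unfolding edge_pair_common by blast
    qed
    then show "edge_pair VS LS u v"
      using e u v B_VS unfolding edge_pair_common c by blast
  qed
qed

text \<open>A facet through both points cannot be outer because of \<open>u\<close>, nor inner
  because of \<open>v\<close>, and \<open>v\<close> lies on at most one coordinate facet.\<close>

lemma edge_crossing:
  assumes u: "u \<in> A" and v: "v \<in> B" "v \<notin> VP"
  shows "\<not> edge_pair VS LS u v"
proof
  assume e: "edge_pair VS LS u v"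
  have far: "1 < csum v" "\<And>i j. v $ i = 0 \<Longrightarrow> v $ j = 0 \<Longrightarrow> i = j"
    using v P.unit_in B_cases by metis+
  have c: "\<exists>i. h = coord i" if h: "h \<in> LS" "h u = 0" "h v = 0" for h
    using h(1)
  proof (cases rule: LS_cases)
    case 2
    then show ?thesis using inner_pos[OF 2 B_nonneg far(1)] v h by auto
  next
    case 3
    then show ?thesis using outer_pos[OF 3, of u] A_nonneg u h by auto
  qed auto
  show False using edge_not_only_coord[OF e unit_VS c] far(2) by blast
qed

text \<open>Pairs of unit vectors are assigned to \<open>R\<close> by \<open>edge_B\<close>, so the
  first set omits exactly the edges of \<open>P\<close> inside the common tetrahedron.\<close>

lemma edge_set_VS:
  "edge_set VS LS = {E \<in> edge_set VP LP. E \<inter> A \<noteq> {}} \<union> {E \<in> edge_set VR LR. 0 \<notin> E}"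
proof (intro equalityI subsetI)
  fix E assume "E \<in> edge_set VS LS"
  then obtain u v where e: "edge_pair VS LS u v" and E: "E = {u, v}"
    unfolding edge_set_def mem_Collect_eq by metis
  have A: "E \<in> {E \<in> edge_set VP LP. E \<inter> A \<noteq> {}}" if "edge_pair VS LS p q" "p \<in> A" "E = {p, q}" for p q
  proof -
    have "q \<in> VP"
      using that edge_crossing[of p q] VS_cases[of q] unfolding edge_pair_def by blast
    then have "edge_pair VP LP p q" using that edge_A by blast
    then show ?thesis using that unfolding edge_set_def by blast
  qed
  show "E \<in> {E \<in> edge_set VP LP. E \<inter> A \<noteq> {}} \<union> {E \<in> edge_set VR LR. 0 \<notin> E}"
  proof (cases "u \<in> A \<or> v \<in> A")
    case True
    then show ?thesis
    proof
      assume "u \<in> A"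
      then show ?thesis using A[OF e _ E] by blast
    next
      assume "v \<in> A"
      moreover have "E = {v, u}" using E by blast
      ultimately show ?thesis using A[OF edge_pair_sym[OF e]] by blast
    qed
  next
    case False
    then have uv: "u \<in> B" "v \<in> B" using e False by (auto simp: edge_pair_def glue_V_def)
    then have "edge_pair VR LR u v" using e edge_B by blast
    then show ?thesis using E uv unfolding edge_set_def by blast
  qed
next
  fix E assume "E \<in> {E \<in> edge_set VP LP. E \<inter> A \<noteq> {}} \<union> {E \<in> edge_set VR LR. 0 \<notin> E}"
  then show "E \<in> edge_set VS LS"
  proof
    assume "E \<in> {E \<in> edge_set VP LP. E \<inter> A \<noteq> {}}"
    then obtain p q where pq: "edge_pair VP LP p q" "E = {p, q}" "E \<inter> A \<noteq> {}"
      unfolding edge_set_def by blast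
    have "\<exists>u v. edge_pair VP LP u v \<and> E = {u, v} \<and> u \<in> A"
    proof (cases "p \<in> A")
      case True
      then show ?thesis using pq by blast
    next
      case False
      then have "q \<in> A" "E = {q, p}" using pq by blast+
      then show ?thesis using edge_pair_sym[OF pq(1)] by blast
    qed
    then obtain u v where uv: "edge_pair VP LP u v" "E = {u, v}" "u \<in> A" by blast
    have "v \<in> VP" using uv(1) by (simp add: edge_pair_def)
    then have "edge_pair VS LS u v" using edge_A[OF uv(3)] uv(1) by blast
    then show ?thesis using uv(2) unfolding edge_set_def by blast
  next
    assume "E \<in> {E \<in> edge_set VR LR. 0 \<notin> E}"
    then obtain u v where "edge_pair VR LR u v" "E = {u, v}" "0 \<notin> E"
      unfolding edge_set_def by blast
    moreover from this have "u \<in> B" "v \<in> B" unfolding edge_pair_def by blast+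
    ultimately have "edge_pair VS LS u v" "E = {u, v}" using edge_B by blast+
    then show ?thesis unfolding edge_set_def by blast
  qed
qed

section \<open>Vertex and edge numbers of the glued polytope\<close>

lemma card_unit_edges: "card {E \<in> edge_set VP LP. E \<inter> A = {}} = 6"
proof -
  have "{E \<in> edge_set VP LP. E \<inter> A = {}} = {K. K \<subseteq> range unit \<and> card K = 2}"
  proof (intro equalityI subsetI)
    fix E assume "E \<in> {E \<in> edge_set VP LP. E \<inter> A = {}}"
    then obtain u v where uv: "u \<in> VP" "v \<in> VP" "u \<noteq> v" "E = {u, v}" "E \<inter> A = {}"
      unfolding edge_set_def edge_pair_def by blast
    then have "u \<in> range unit" "v \<in> range unit" using P.near by blast+
    then show "E \<in> {K. K \<subseteq> range unit \<and> card K = 2}" using uv by simp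
  next
    fix K assume "K \<in> {K. K \<subseteq> range unit \<and> card K = 2}"
    then obtain a b where ab: "K = {a, b}" "a \<noteq> b" "K \<subseteq> range unit" by (auto simp: card_2_iff)
    then obtain i j where "a = unit i" "b = unit j" by blast
    then have ij: "K = {unit i, unit j}" "i \<noteq> j" using ab by auto
    then have "K \<in> edge_set VP LP" using edge_units_P unfolding edge_set_def by blast
    moreover have "K \<inter> A = {}" using ij by auto
    ultimately show "K \<in> {E \<in> edge_set VP LP. E \<inter> A = {}}" by simp
  qed
  then show ?thesis using n_subsets[of "range unit" 2] card_units by (simp add: choose_two)
qed

text \<open>A facet through 0 is a coordinate facet, and a far vertex lies on at most one of these,
  so only the unit vectors can be adjacent to 0.\<close>

lemma card_origin_edges: "card {E \<in> edge_set VR LR. 0 \<in> E} = 4"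
proof -
  have "{E \<in> edge_set VR LR. 0 \<in> E} = (\<lambda>i. {0, unit i}) ` UNIV"
  proof (intro equalityI subsetI)
    fix E assume "E \<in> {E \<in> edge_set VR LR. 0 \<in> E}"
    then obtain p q where pq: "edge_pair VR LR p q" "E = {p, q}" "0 \<in> E"
      unfolding edge_set_def by blast
    have "\<exists>v. edge_pair VR LR 0 v \<and> E = {0, v}"
    proof (cases "p = 0")
      case True
      then show ?thesis using pq by blast
    next
      case False
      then have "q = 0" "E = {q, p}" using pq by blast+
      then show ?thesis using edge_pair_sym[OF pq(1)] by blast
    qed
    then obtain v where e: "edge_pair VR LR 0 v" and E: "E = {0, v}" by blast
    have "v \<in> B" using e by (auto simp: edge_pair_def)
    then show "E \<in> (\<lambda>i. {0, unit i}) ` UNIV"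
    proof (cases rule: B_cases)
      case (1 i)
      then show ?thesis using E by simp
    next
      case 2
      have "\<exists>i. h = coord i" if "h \<in> LR" "h 0 = 0" "h v = 0" for h
        using that R.noncoord[of h] by force
      then show ?thesis using edge_not_only_coord[OF e R.unit_in] 2(2) by blast
    qed
  next
    fix E assume "E \<in> (\<lambda>i. {0, unit i}) ` UNIV"
    then obtain i where E: "E = {0, unit i}" by auto
    have "edge_pair VR LR 0 (unit i)" unfolding edge_pair_def
    proof (intro conjI ballI impI)
      show "0 \<in> VR" "unit i \<in> VR" using R.origin_in R.unit_in by auto
      show "0 \<noteq> unit i" by (metis unit_neq_0)
      fix w assume w: "w \<in> VR" "\<forall>h\<in>LR. h 0 = 0 \<longrightarrow> h (unit i) = 0 \<longrightarrow> h w = 0"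
      have z: "w $ j = 0" if "j \<noteq> i" for j
        using bspec[OF w(2) R.coord_in, of j] that by (simp add: unit_nth)
      show "w = 0 \<or> w = unit i"
      proof (cases "w = 0")
        case False
        then have "w \<in> B" using w by simp
        then show ?thesis
        proof (cases rule: B_cases)
          case (1 m)
          then show ?thesis using z[of m] by (auto simp: unit_nth)
        next
          case 2
          have "card (- {i}) = 3" by (simp add: Compl_eq_Diff_UNIV card_Diff_subset)
          then obtain a b where "a \<in> - {i}" "b \<in> - {i}" "a \<noteq> b" by (auto simp: card_3_iff)
          then show ?thesis using 2(2)[of a b] z by auto
        qed
      qed simp
    qed
    then show "E \<in> {E \<in> edge_set VR LR. 0 \<in> E}" using E unfolding edge_set_def by blast
  qed
  moreover have "inj (\<lambda>i. {0, unit i})" by (auto simp: inj_on_def doubleton_eq_iff)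
  ultimately show ?thesis by (simp add: card_image)
qed

lemma card_VS: "card VS + 5 = card VP + card VR"
proof -
  have "VP = A \<union> range unit" using P.near P.unit_in by blast
  moreover have "A \<inter> range unit = {}" by auto
  ultimately have "card VP = card A + 4"
    using P.finite_V card_units by (metis (no_types, lifting) card_Un_disjoint finite_Un)
  moreover have "card VR = card B + 1"
    using R.origin_in R.finite_V by (metis card.remove Suc_eq_plus1)
  moreover have "card VS = card A + card B"
    unfolding glue_V_def using P.finite_V R.finite_V A_B_disjoint by (intro card_Un_disjoint) auto
  ultimately show ?thesis by simp
qed

text \<open>What is lost are the 6 edges of \<open>P\<close> between unit vectors and the 4 edges of
  \<open>R\<close> at 0. This total of 10 makes the count 4 k - 10 persist while 5 vertices are
  lost.\<close>

lemma card_edge_set_VS: "card (edge_set VS LS) + 10 = card (edge_set VP LP) + card (edge_set VR LR)"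
proof -
  let ?X = "{E \<in> edge_set VP LP. E \<inter> A \<noteq> {}}" and ?Y = "{E \<in> edge_set VR LR. 0 \<notin> E}"
  note fin = finite_edge_set[OF P.finite_V, of LP] finite_edge_set[OF R.finite_V, of LR]
  have "?X \<inter> ?Y = {}"
  proof -
    have "E \<subseteq> B" if "E \<in> ?Y" for E using that unfolding edge_set_def edge_pair_def by blast
    then show ?thesis using A_B_disjoint by blast
  qed
  then have "card (edge_set VS LS) = card ?X + card ?Y"
    unfolding edge_set_VS using fin by (intro card_Un_disjoint) auto
  moreover have "card (edge_set VP LP) = card ?X + 6"
  proof -
    have "card (?X \<union> {E \<in> edge_set VP LP. E \<inter> A = {}}) = card ?X + card {E \<in> edge_set VP LP. E \<inter> A = {}}"
      using fin by (intro card_Un_disjoint) auto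
    moreover have "?X \<union> {E \<in> edge_set VP LP. E \<inter> A = {}} = edge_set VP LP" by blast
    ultimately show ?thesis using card_unit_edges by simp
  qed
  moreover have "card (edge_set VR LR) = card ?Y + 4"
  proof -
    have "card (?Y \<union> {E \<in> edge_set VR LR. 0 \<in> E}) = card ?Y + card {E \<in> edge_set VR LR. 0 \<in> E}"
      using fin by (intro card_Un_disjoint) auto
    moreover have "?Y \<union> {E \<in> edge_set VR LR. 0 \<in> E} = edge_set VR LR" by blast
    ultimately show ?thesis using card_origin_edges by simp
  qed
  ultimately show ?thesis by simp
qed

section \<open>The glued system satisfies the polytope conditions\<close>

lemma far_inner_zero:
  assumes "h \<in> LS" "h w = 0" "1 < csum w" "\<And>i. 0 \<le> w $ i"
  shows "h \<in> LR"
  using assms(1)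
proof (cases rule: LS_cases)
  case (1 i)
  then show ?thesis using R.coord_in by simp
next
  case 2
  then show ?thesis using inner_pos[OF 2 assms(4,3)] assms(2) by simp
qed

lemma near_zero:
  assumes "h \<in> LS" "h w = 0" "csum w < 1" "\<And>i. 0 \<le> w $ i"
  shows "h \<in> LP"
  using assms(1)
proof (cases rule: LS_cases)
  case (1 i)
  then show ?thesis using P.coord_in by simp
next
  case 3
  then show ?thesis using outer_pos[OF 3 assms(4,3)] assms(2) by simp
qed

lemma LS_unit_nonneg: "h \<in> LS \<Longrightarrow> 0 \<le> h (unit i)"
  using P.V_nonneg[OF P.unit_in] R.V_nonneg[OF R.unit_in] by (auto simp: glue_L_def)

lemma VS_nonneg: "v \<in> VS \<Longrightarrow> 0 \<le> v $ i"
  using A_nonneg B_nonneg by (auto simp: glue_V_def)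

lemma nonneg_VS:
  assumes v: "v \<in> VS" and h: "h \<in> LS"
  shows "0 \<le> h v"
  using h
proof (cases rule: LS_cases)
  case (1 i)
  then show ?thesis using VS_nonneg[OF v] by simp
next
  case 2
  from v show ?thesis
  proof (cases rule: VS_cases)
    case 1
    then show ?thesis using P.V_nonneg 2 by simp
  next
    case B: 2
    then show ?thesis
    proof (cases rule: B_cases)
      case (1 i)
      then show ?thesis using LS_unit_nonneg[OF h] by simp
    next
      case far: 2
      then show ?thesis using inner_pos[OF 2 VS_nonneg[OF v]] by simp
    qed
  qed
next
  case 3
  from v show ?thesis
  proof (cases rule: VS_cases)
    case 1
    then show ?thesis using outer_pos[OF 3 VS_nonneg[OF v]] by simp
  next
    case 2
    then show ?thesis using R.V_nonneg 3 by simp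
  qed
qed

lemma hpoly_near: "x \<in> hpoly LS \<Longrightarrow> csum x \<le> 1 \<Longrightarrow> x \<in> hpoly LP"
  by (auto simp: hpoly_def glue_L_def)

lemma hpoly_far: "x \<in> hpoly LS \<Longrightarrow> x \<in> hpoly LR"
  by (auto simp: hpoly_def glue_L_def)

lemma hpoly_nonneg: "x \<in> hpoly LS \<Longrightarrow> 0 \<le> x $ i"
  using coord_LS by (auto simp: hpoly_def)

lemma bounded_LS: "bounded (hpoly LS)"
  using R.bounded_hpoly by (rule bounded_subset) (auto intro: hpoly_far)

text \<open>Before the hyperplane a vertex of \<open>P\<close> dominates, beyond it a vertex of
  \<open>R\<close>. On the hyperplane \<open>x\<close> is a convex combination of unit vectors, and
  any of them with positive weight lies on all facets tight at \<open>x\<close>. If \<open>R\<close>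
  offers the removed vertex 0, only coordinate facets are tight and a unit vector replaces
  it.\<close>

lemma dominated_LS:
  assumes x: "x \<in> hpoly LS"
  shows "\<exists>v\<in>VS. \<forall>h\<in>LS. h x = 0 \<longrightarrow> h v = 0"
proof -
  note nn = hpoly_nonneg[OF x]
  consider "csum x < 1" | "csum x = 1" | "1 < csum x" by linarith
  then show ?thesis
  proof cases
    case 1
    then obtain v where v: "v \<in> VP" "\<forall>h\<in>LP. h x = 0 \<longrightarrow> h v = 0"
      using P.dominated[OF hpoly_near[OF x]] by auto
    have "h v = 0" if "h \<in> LS" "h x = 0" for h
      using v(2) near_zero[OF that 1 nn] that by blast
    then show ?thesis using v VP_VS by blast
  next
    case 2
    obtain m where m: "x $ m \<noteq> 0" using csum_pos_ex[of x] 2 by auto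
    have "h (unit m) = 0" if h: "h \<in> LS" "h x = 0" for h
    proof -
      have "(\<Sum>i\<in>UNIV. x $ i * h (unit i)) = 0"
        using affine_fun_expand[OF LS_affine[OF h(1)], of x] h 2 by simp
      then have "x $ m * h (unit m) = 0"
        using nn LS_unit_nonneg[OF h(1)] by (subst (asm) sum_nonneg_eq_0_iff) auto
      then show ?thesis using m by simp
    qed
    then show ?thesis using unit_VS by blast
  next
    case 3
    obtain v where v: "v \<in> VR" "\<forall>h\<in>LR. h x = 0 \<longrightarrow> h v = 0"
      using R.dominated[OF hpoly_far[OF x]] by auto
    have z: "h \<in> LR" "h v = 0" if "h \<in> LS" "h x = 0" for h
      using v(2) far_inner_zero[OF that 3 nn] that by blast+
    show ?thesis
    proof (cases "v = 0")
      case False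
      then show ?thesis using v z B_VS[of v] by blast
    next
      case True
      obtain m where m: "x $ m \<noteq> 0" using csum_pos_ex[of x] 3 by auto
      have "h (unit m) = 0" if h: "h \<in> LS" "h x = 0" for h
      proof -
        obtain i where i: "h = coord i" using z[OF h] True R.noncoord[of h] by force
        then have "i \<noteq> m" using h m by auto
        then show ?thesis using i by (simp add: unit_nth)
      qed
      then show ?thesis using unit_VS by blast
    qed
  qed
qed

text \<open>The new case has \<open>v\<close> and \<open>w\<close> on different sides. If
  \<open>v\<close> is not a unit vector, the facets through it are all coordinate facets;
  \<open>unit m\<close> with \<open>v $ m\<close> nonzero lies on all of them, and uniqueness in the
  old polytope makes it equal to \<open>v\<close>. If \<open>v\<close> is a unit vector,
  \<open>cap\<close> gives a facet through it that misses \<open>w\<close>.\<close>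

lemma unique_VS:
  assumes v: "v \<in> VS" and w: "w \<in> VS" and vw: "\<And>h. h \<in> LS \<Longrightarrow> h v = 0 \<Longrightarrow> h w = 0"
  shows "w = v"
  using v
proof (cases rule: VS_cases)
  case vA: 1
  show ?thesis
  proof (cases "w \<in> VP")
    case True
    then show ?thesis using P.vertex_unique[of v w] vA vw LP_LS by auto
  next
    case False
    then have B: "w \<in> B" using w VS_cases by blast
    then have far: "1 < csum w" using False P.unit_in B_cases by metis
    have "v \<noteq> 0"
    proof
      assume "v = 0"
      then have "w $ i = 0" for i using vw[OF coord_LS, of i] by simp
      then show False using far csum_pos_ex[of w] by auto
    qed
    then obtain m where m: "v $ m \<noteq> 0" by (metis vec_eq_iff zero_index)
    have "h (unit m) = 0" if h: "h \<in> LP" "h v = 0" for h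
    proof -
      have hS: "h \<in> LS" using LP_LS h vA by blast
      have hw: "h w = 0" using vw[OF hS h(2)] .
      have "h \<in> LR" using far_inner_zero[OF hS hw far] B_nonneg B by blast
      moreover have "\<not> 0 < h 0" using outer_pos[of h v] h vA A_nonneg \<open>h \<in> LR\<close> by auto
      ultimately obtain i where i: "h = coord i" using R.noncoord[of h] by blast
      then have "i \<noteq> m" using h m by auto
      then show ?thesis using i by (simp add: unit_nth)
    qed
    then have "unit m = v" using P.vertex_unique[OF _ P.unit_in] vA by blast
    then show ?thesis using vA by auto
  qed
next
  case vB: 2
  have R: "w = v" if "w \<in> B"
    using R.vertex_unique[of v w] that vB vw LR_LS by blast
  show ?thesis
  proof (cases "w \<in> A")
    case False
    then show ?thesis using R w VS_cases by blast
  next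
    case wA: True
    have pos: "\<exists>i. h = coord i" if h: "h \<in> LR" "h v = 0" for h
    proof -
      have "h w = 0" using vw LR_LS h by blast
      then show ?thesis using outer_pos[of h w] h wA A_nonneg R.noncoord[of h] by force
    qed
    from vB show ?thesis
    proof (cases rule: B_cases)
      case (1 i)
      have "card (- {i}) = 3" by (simp add: Compl_eq_Diff_UNIV card_Diff_subset)
      then obtain j where "i \<noteq> j" by (auto simp: card_3_iff)
      then obtain h where h: "h \<in> LR" "h (unit i) = 0" "0 < h 0" using R.cap by blast
      then show ?thesis using pos[of h] 1 by auto
    next
      case far: 2
      then obtain m where m: "v $ m \<noteq> 0" using csum_pos_ex[of v] by auto
      have "h (unit m) = 0" if h: "h \<in> LR" "h v = 0" for h
      proof -
        obtain i where i: "h = coord i" using pos[OF h] by blast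
        then have "i \<noteq> m" using h m by auto
        then show ?thesis using i by (simp add: unit_nth)
      qed
      then have "unit m = v" using R.vertex_unique[OF _ R.unit_in] vB by blast
      then show ?thesis using far by auto
    qed
  qed
qed

text \<open>The types of the two facets decide in which old polytope all their common vertices lie.
  Only an inner and an outer facet come from different polytopes; they meet in at most one unit
  vector. Two coordinate facets are treated in \<open>P\<close>, because a far vertex has at most
  one zero coordinate.\<close>

lemma facets_meet_LS:
  assumes h: "h \<in> LS" "h' \<in> LS" "h \<noteq> h'"
  shows "card {v \<in> VS. h v = 0 \<and> h' v = 0} \<le> 3"
proof -
  have P: ?thesis
    if "h \<in> LP" "h' \<in> LP" "{v \<in> VS. h v = 0 \<and> h' v = 0} \<subseteq> {v \<in> VP. h v = 0 \<and> h' v = 0}"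
    using card_mono[OF _ that(3)] P.facets_meet[OF that(1,2) h(3)] P.finite_V by simp
  have inner: "v \<in> VP" if "g \<in> LP" "g 0 < 0" "v \<in> VS" "g v = 0" for g v
    using that(3)
  proof (cases rule: VS_cases)
    case 2
    then show ?thesis
    proof (cases rule: B_cases)
      case (1 i)
      then show ?thesis using P.unit_in by simp
    next
      case far: 2
      then show ?thesis using inner_pos[OF that(1,2) B_nonneg far(1)] 2 that(4) by auto
    qed
  qed auto
  have outer: "v \<in> VR" if "g \<in> LR" "0 < g 0" "v \<in> VS" "g v = 0" for g v
    using that(3)
  proof (cases rule: VS_cases)
    case 1
    then show ?thesis using outer_pos[OF that(1,2), of v] A_nonneg that(4) by auto
  qed auto
  have outer_inner: "card {v \<in> VS. p v = 0 \<and> r v = 0} \<le> 3"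
    if p: "p \<in> LP" "p 0 < 0" and r: "r \<in> LR" "0 < r 0" for p r
  proof -
    have "u = v" if "u \<in> {v \<in> VS. p v = 0 \<and> r v = 0}" "v \<in> {v \<in> VS. p v = 0 \<and> r v = 0}" for u v
    proof -
      have "\<exists>i. w = unit i" if w: "w \<in> VS" "p w = 0" "r w = 0" for w
      proof -
        have "w \<in> VP" "w \<notin> A"
          using inner[OF p w(1,2)] outer_pos[OF r, of w] A_nonneg w(3) by auto
        then show ?thesis using VP_cases by blast
      qed
      then show ?thesis using that inner_one_unit[OF p] by blast
    qed
    moreover have "finite VS" using P.finite_V R.finite_V by (simp add: glue_V_def)
    ultimately have "card {v \<in> VS. p v = 0 \<and> r v = 0} \<le> Suc 0"
      by (subst card_le_Suc0_iff_eq) auto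
    then show ?thesis by simp
  qed
  have Rm: ?thesis
    if "h \<in> LR" "h' \<in> LR" "{v \<in> VS. h v = 0 \<and> h' v = 0} \<subseteq> {v \<in> VR. h v = 0 \<and> h' v = 0}"
    using card_mono[OF _ that(3)] R.facets_meet[OF that(1,2) h(3)] R.finite_V by simp
  from h(1) show ?thesis
  proof (cases rule: LS_cases)
    case hi: (1 i)
    from h(2) show ?thesis
    proof (cases rule: LS_cases)
      case (1 j)
      have "v \<in> VP" if v: "v \<in> VS" "h v = 0" "h' v = 0" for v
      proof (rule ccontr)
        assume nv: "v \<notin> VP"
        then have "v \<in> B" using v VS_cases by blast
        then have "i = j" using B_cases v nv P.unit_in hi 1 by metis
        then show False using h(3) hi 1 by simp
      qed
      then show ?thesis using P hi 1 P.coord_in by blast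
    next
      case 2
      then show ?thesis using P hi P.coord_in inner by blast
    next
      case 3
      then show ?thesis using Rm hi R.coord_in outer by blast
    qed
  next
    case h2: 2
    from h(2) show ?thesis
    proof (cases rule: LS_cases)
      case (1 j)
      then show ?thesis using P h2 P.coord_in inner by blast
    next
      case 2
      then show ?thesis using P h2 inner by blast
    next
      case 3
      then show ?thesis using outer_inner[OF h2 3] by simp
    qed
  next
    case h3: 3
    from h(2) show ?thesis
    proof (cases rule: LS_cases)
      case (1 j)
      then show ?thesis using Rm h3 R.coord_in outer by blast
    next
      case 2
      then show ?thesis using outer_inner[OF 2 h3] by (simp add: conj_commute)
    next
      case 3
      then show ?thesis using Rm h3 outer by blast
    qed
  qed
qed

text \<open>No facet loses a needed vertex: a coordinate or inner facet keeps those it had in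
  \<open>P\<close>, and an outer facet never contained the removed vertex 0.\<close>

lemma facet_dim_LS:
  assumes h: "h \<in> LS"
  shows "3 \<le> aff_dim {v \<in> VS. h v = 0}"
proof -
  have P: ?thesis if "h \<in> LP"
  proof -
    have "3 \<le> aff_dim {v \<in> VP. h v = 0}" using P.facet_dim[OF that] .
    also have "\<dots> \<le> aff_dim {v \<in> VS. h v = 0}" using VP_VS by (intro aff_dim_subset) auto
    finally show ?thesis .
  qed
  from h show ?thesis
  proof (cases rule: LS_cases)
    case (1 i)
    then show ?thesis using P P.coord_in by simp
  next
    case 2
    then show ?thesis using P by simp
  next
    case 3
    have "3 \<le> aff_dim {v \<in> VR. h v = 0}" using R.facet_dim[OF 3(1)] .
    also have "\<dots> \<le> aff_dim {v \<in> VS. h v = 0}"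
      using 3(2) by (intro aff_dim_subset) (auto simp: glue_V_def)
    finally show ?thesis .
  qed
qed

lemma edge_degree_LS:
  assumes e: "edge_pair VS LS u v"
  shows "card {h \<in> LS. h u = 0 \<and> h v = 0} = 3"
proof -
  have A: "card {h \<in> LS. h p = 0 \<and> h q = 0} = 3" if e: "edge_pair VS LS p q" and p: "p \<in> A" for p q
  proof -
    have "q \<in> VP"
      using that edge_crossing[of p q] VS_cases[of q] unfolding edge_pair_def by blast
    then have "edge_pair VP LP p q" using that edge_A by blast
    then show ?thesis unfolding common_A[OF p] by (rule P.edge_degree)
  qed
  consider "u \<in> A" | "v \<in> A" | "u \<in> B" "v \<in> B"
    using e by (auto simp: edge_pair_def glue_V_def)
  then show ?thesis
  proof cases
    case 1
    then show ?thesis using A e by blast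
  next
    case 2
    then show ?thesis using A[OF edge_pair_sym[OF e]] by (simp add: conj_commute)
  next
    case 3
    have "u \<noteq> v" using e by (simp add: edge_pair_def)
    then show ?thesis
      using R.edge_degree[of u v] edge_B[OF 3] e common_B[OF 3] by simp
  qed
qed

theorem glued: "two_two_polytope VS LS"
proof
  show "finite VS" "finite LS"
    using P.finite_V R.finite_V P.finite_L R.finite_L by (auto simp: glue_V_def glue_L_def)
  show "affine_fun h" if "h \<in> LS" for h using LS_affine that .
  show "0 \<le> h v" if "v \<in> VS" "h \<in> LS" for v h using nonneg_VS that .
  show "bounded (hpoly LS)" by (rule bounded_LS)
  show "\<exists>v\<in>VS. \<forall>h\<in>LS. h x = 0 \<longrightarrow> h v = 0" if "x \<in> hpoly LS" for x using dominated_LS that .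
  show "w = v" if "v \<in> VS" "w \<in> VS" "\<And>h. h \<in> LS \<Longrightarrow> h v = 0 \<Longrightarrow> h w = 0" for v w
    using unique_VS that .
  show "\<exists>h\<in>LS. \<exists>h'\<in>LS. h \<noteq> h'"
    using coord_LS[of 1] coord_LS[of 2] coord_inj[of 1 2] by auto
  show "card {v \<in> VS. h v = 0 \<and> h' v = 0} \<le> 3" if "h \<in> LS" "h' \<in> LS" "h \<noteq> h'" for h h'
    using facets_meet_LS that .
  show "3 \<le> aff_dim {v \<in> VS. h v = 0}" if "h \<in> LS" for h using facet_dim_LS that .
  show "card {h \<in> LS. h u = 0 \<and> h v = 0} = 3" if "edge_pair VS LS u v" for u v
    using edge_degree_LS that .
  show "card (edge_set VS LS) + 10 = 4 * card VS"
    using card_edge_set_VS card_VS P.edge_count R.edge_count by linarith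
qed

end

section \<open>Affine images\<close>

text \<open>Points move by \<open>T\<close> and functionals by composition with its inverse
  \<open>T'\<close>, so all incidences are preserved.\<close>

lemma two_two_polytope_affine_image:
  fixes T T' :: "real^4 \<Rightarrow> real^4"
  assumes tt: "two_two_polytope V L"
    and T: "T = (\<lambda>x. f x + c)" "linear f" and T': "T' = (\<lambda>x. f' x + c')" "linear f'"
    and inv: "\<And>x. T' (T x) = x" "\<And>x. T (T' x) = x"
  shows "two_two_polytope (T ` V) ((\<lambda>h. h \<circ> T') ` L)"
proof -
  interpret two_two_polytope V L by (rule tt)
  let ?L = "(\<lambda>h. h \<circ> T') ` L"
  have injT: "inj T" using inv(1) by (metis injI)
  have injL: "inj_on (\<lambda>h. h \<circ> T') L"
    by (rule inj_onI) (metis comp_apply ext inv(1))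
  have injf: "inj f"
  proof (rule injI)
    fix x y assume "f x = f y"
    then have "T x = T y" using T by simp
    then show "x = y" using injT by (simp add: inj_eq)
  qed
  have ad: "aff_dim (T ` X) = aff_dim X" for X
  proof -
    have "T ` X = (\<lambda>x. c + x) ` (f ` X)" using T(1) by (auto simp: image_iff add.commute)
    then show ?thesis using aff_dim_injective_linear_image[OF T(2) injf] by (simp add: aff_dim_translation_eq)
  qed
  have hp: "hpoly ?L = T ` hpoly L"
  proof (intro equalityI subsetI)
    fix x assume "x \<in> hpoly ?L"
    then have "T' x \<in> hpoly L" by (auto simp: hpoly_def)
    then show "x \<in> T ` hpoly L" using inv(2) by (metis imageI)
  qed (auto simp: hpoly_def inv)
  have ep: "edge_pair (T ` V) ?L (T u) (T v) \<longleftrightarrow> edge_pair V L u v" for u v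
    using injT by (simp add: edge_pair_def inv inj_eq inj_image_mem_iff)
  have es: "edge_set (T ` V) ?L = (\<lambda>E. T ` E) ` edge_set V L"
  proof (intro equalityI subsetI)
    fix E assume "E \<in> edge_set (T ` V) ?L"
    then obtain a b where ab: "edge_pair (T ` V) ?L a b" "E = {a, b}" unfolding edge_set_def by blast
    then obtain u v where uv: "a = T u" "b = T v" unfolding edge_pair_def by blast
    then have "{u, v} \<in> edge_set V L" using ab ep unfolding edge_set_def by blast
    moreover have "E = T ` {u, v}" using ab uv by simp
    ultimately show "E \<in> (\<lambda>E. T ` E) ` edge_set V L" by blast
  next
    fix E assume "E \<in> (\<lambda>E. T ` E) ` edge_set V L"
    then obtain u v where "edge_pair V L u v" "E = T ` {u, v}" unfolding edge_set_def by blast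
    then have "edge_pair (T ` V) ?L (T u) (T v)" "E = {T u, T v}" using ep by auto
    then show "E \<in> edge_set (T ` V) ?L" unfolding edge_set_def by blast
  qed
  have img: "{v \<in> T ` V. P v} = T ` {v \<in> V. P (T v)}" for P by auto
  show ?thesis
  proof
    show "finite (T ` V)" "finite ?L" using finite_V finite_L by auto
    show "affine_fun h" if h: "h \<in> ?L" for h
    proof -
      obtain g where g: "g \<in> L" "h = g \<circ> T'" using h by auto
      obtain a b where "\<And>x. g x = a \<bullet> x + b" using affine_L[OF g(1)] unfolding affine_fun_def by blast
      then have "h x = adjoint f' a \<bullet> x + (a \<bullet> c' + b)" for x
        using g T' by (simp add: inner_add_right adjoint_works inner_commute)
      then show ?thesis unfolding affine_fun_def by blast
    qed
    show "0 \<le> h v" if "v \<in> T ` V" "h \<in> ?L" for v h using that V_nonneg by (auto simp: inv)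
    show "bounded (hpoly ?L)"
    proof -
      have "T ` hpoly L = (\<lambda>x. c + x) ` (f ` hpoly L)" using T(1) by (auto simp: image_iff add.commute)
      moreover have "bounded (f ` hpoly L)"
        using bounded_linear_image[OF bounded_hpoly] T(2) linear_conv_bounded_linear by blast
      ultimately show ?thesis unfolding hp using bounded_translation by metis
    qed
    show "\<exists>v\<in>T ` V. \<forall>h\<in>?L. h x = 0 \<longrightarrow> h v = 0" if x: "x \<in> hpoly ?L" for x
    proof -
      obtain y where y: "y \<in> hpoly L" "x = T y" using x hp by auto
      then show ?thesis using dominated[OF y(1)] by (auto simp: inv)
    qed
    show "w = v" if "v \<in> T ` V" "w \<in> T ` V" "\<And>h. h \<in> ?L \<Longrightarrow> h v = 0 \<Longrightarrow> h w = 0" for v w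
    proof -
      obtain p q where pq: "p \<in> V" "v = T p" "q \<in> V" "w = T q" using \<open>v \<in> T ` V\<close> \<open>w \<in> T ` V\<close> by blast
      have "q = p"
      proof (rule vertex_unique[OF pq(1,3)])
        fix h assume "h \<in> L" "h p = 0"
        then show "h q = 0" using that(3)[of "h \<circ> T'"] pq inv by simp
      qed
      then show ?thesis using pq by simp
    qed
    show "\<exists>h\<in>?L. \<exists>h'\<in>?L. h \<noteq> h'"
    proof -
      obtain h h' where h: "h \<in> L" "h' \<in> L" "h \<noteq> h'" using two_facets by blast
      then have "h \<circ> T' \<noteq> h' \<circ> T'" using injL unfolding inj_on_def by blast
      then show ?thesis using h by blast
    qed
    show "card {v \<in> T ` V. h v = 0 \<and> h' v = 0} \<le> 3" if h: "h \<in> ?L" "h' \<in> ?L" "h \<noteq> h'" for h h'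
    proof -
      obtain g g' where g: "g \<in> L" "h = g \<circ> T'" "g' \<in> L" "h' = g' \<circ> T'" using h by auto
      then have "g \<noteq> g'" using h by auto
      then show ?thesis using facets_meet[of g g'] g
        by (simp add: img inv card_image inj_on_subset[OF injT])
    qed
    show "3 \<le> aff_dim {v \<in> T ` V. h v = 0}" if h: "h \<in> ?L" for h
      using h facet_dim by (auto simp: img inv ad)
    show "card {h \<in> ?L. h u = 0 \<and> h v = 0} = 3" if e: "edge_pair (T ` V) ?L u v" for u v
    proof -
      obtain p q where pq: "u = T p" "v = T q" using e unfolding edge_pair_def by blast
      then have "edge_pair V L p q" using e ep by simp
      moreover have "{h \<in> ?L. h u = 0 \<and> h v = 0} = (\<lambda>h. h \<circ> T') ` {h \<in> L. h p = 0 \<and> h q = 0}"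
        using pq inv by auto
      moreover have "inj_on (\<lambda>h. h \<circ> T') {h \<in> L. h p = 0 \<and> h q = 0}"
        using injL by (rule inj_on_subset) auto
      ultimately show ?thesis using edge_degree by (simp add: card_image)
    qed
    have "inj_on (\<lambda>E. T ` E) (edge_set V L)" using injT by (auto simp: inj_on_def inj_image_eq_iff)
    then show "card (edge_set (T ` V) ?L) + 10 = 4 * card (T ` V)"
      using edge_count injT by (simp add: es card_image inj_on_subset[OF injT])
  qed
qed

section \<open>Certificates from incidence matrices\<close>

definition inc_row :: "('a \<Rightarrow> real) list \<Rightarrow> 'a \<Rightarrow> bool list" where
  "inc_row hs v = map (\<lambda>h. h v = 0) hs"

definition row_le :: "bool list \<Rightarrow> bool list \<Rightarrow> bool" where
  "row_le r s = list_all2 (\<longrightarrow>) r s"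

definition row_meet :: "bool list \<Rightarrow> bool list \<Rightarrow> bool list" where
  "row_meet r s = map2 (\<and>) r s"

text \<open>When \<open>r\<close> and \<open>s\<close> belong to \<open>rs\<close> and the rows are
  distinct, the two rows counted are \<open>r\<close> and \<open>s\<close> themselves.\<close>

definition row_edge :: "bool list list \<Rightarrow> bool list \<Rightarrow> bool list \<Rightarrow> bool" where
  "row_edge rs r s \<longleftrightarrow> r \<noteq> s \<and> length (filter (row_le (row_meet r s)) rs) = 2"

text \<open>A maximal chain inside one facet: each of \<open>c\<close>, \<open>d\<close> is separated from the previous points by
  another facet, so the facet is 3-dimensional.\<close>
definition row_flag :: "bool list list \<Rightarrow> bool" where
  "row_flag F \<longleftrightarrow> (\<exists>a\<in>set F. \<exists>b\<in>set F. a \<noteq> b \<and> (\<exists>c\<in>set F. \<not> row_le (row_meet a b) c \<and>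
     (\<exists>d\<in>set F. \<not> row_le (row_meet (row_meet a b) c) d)))"

text \<open>The last line is f_1 + 10 = 4 f_0 doubled, because \<open>List.product\<close> runs over
  ordered pairs.\<close>

definition incidence_check :: "nat \<Rightarrow> bool list list \<Rightarrow> bool" where
  "incidence_check n rs \<longleftrightarrow> 2 \<le> n \<and> distinct rs \<and>
     (\<forall>r\<in>set rs. \<forall>s\<in>set rs. row_le r s \<longrightarrow> s = r) \<and>
     (\<forall>j\<in>set [0..<n]. \<forall>k\<in>set [0..<n]. j \<noteq> k \<longrightarrow> length (filter (\<lambda>r. r ! j \<and> r ! k) rs) \<le> 3) \<and>
     (\<forall>j\<in>set [0..<n]. row_flag (filter (\<lambda>r. r ! j) rs)) \<and>
     (\<forall>r\<in>set rs. \<forall>s\<in>set rs. row_edge rs r s \<longrightarrow> length (filter id (row_meet r s)) = 3) \<and>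
     length (filter (\<lambda>(r, s). row_edge rs r s) (List.product rs rs)) + 20 = 8 * length rs"

lemma row_meet_map: "row_meet (map f hs) (map g hs) = map (\<lambda>h. f h \<and> g h) hs"
  by (simp add: row_meet_def map2_map_map)

lemma row_le_map: "row_le (map f hs) (map g hs) \<longleftrightarrow> (\<forall>h\<in>set hs. f h \<longrightarrow> g h)"
  by (simp add: row_le_def list_all2_map1 list_all2_map2 list_all2_same)

text \<open>An ordered pair is the same as an edge together with one of its two endpoints.\<close>

lemma card_edge_set_ordered:
  assumes "finite V"
  shows "card {(u, v). edge_pair V L u v} = 2 * card (edge_set V L)"
proof -
  have fin: "finite (edge_set V L)"
    using assms by (rule finite_edge_set)
  have c2: "card E = 2" if E: "E \<in> edge_set V L" for E
  proof -
    obtain u v where "edge_pair V L u v" "E = {u, v}" using E unfolding edge_set_def by blast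
    then show ?thesis by (simp add: edge_pair_def)
  qed
  let ?f = "\<lambda>(u, v). ({u, v}, u)"
  have im: "?f ` {(u, v). edge_pair V L u v} = (SIGMA E:edge_set V L. E)"
  proof (intro equalityI subsetI)
    fix p assume "p \<in> ?f ` {(u, v). edge_pair V L u v}"
    then obtain u v where "edge_pair V L u v" "p = ({u, v}, u)" by auto
    then show "p \<in> (SIGMA E:edge_set V L. E)" unfolding edge_set_def by blast
  next
    fix p assume "p \<in> (SIGMA E:edge_set V L. E)"
    then obtain E w where p: "p = (E, w)" "E \<in> edge_set V L" "w \<in> E" by blast
    then obtain u v where uv: "edge_pair V L u v" "E = {u, v}" unfolding edge_set_def by blast
    have "\<exists>z. edge_pair V L w z \<and> E = {w, z}"
    proof (cases "w = u")
      case True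
      then show ?thesis using uv by blast
    next
      case False
      then have "w = v" "E = {v, u}" using uv p by auto
      then show ?thesis using edge_pair_sym[OF uv(1)] by blast
    qed
    then show "p \<in> ?f ` {(u, v). edge_pair V L u v}" using p by force
  qed
  have "inj_on ?f {(u, v). edge_pair V L u v}"
    by (auto simp: inj_on_def doubleton_eq_iff)
  from card_image[OF this] have "card {(u, v). edge_pair V L u v} = card (SIGMA E:edge_set V L. E)"
    unfolding im by simp
  also have "\<dots> = (\<Sum>E\<in>edge_set V L. card E)"
    using fin c2 by (intro card_SigmaI) (auto intro: card_ge_0_finite)
  also have "\<dots> = (\<Sum>E\<in>edge_set V L. 2)" using c2 by (intro sum.cong) auto
  finally show ?thesis by simp
qed

text \<open>\<open>g\<close> separates \<open>c\<close> from the line of \<open>a\<close> and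
  \<open>b\<close>, and \<open>g'\<close> separates \<open>d\<close> from the plane of the first
  three points, so each raises the dimension by one.\<close>

lemma aff_dim_flag:
  assumes "a \<noteq> b"
    and g: "affine_fun g" "g a = 0" "g b = 0" "g c \<noteq> 0"
    and g': "affine_fun g'" "g' a = 0" "g' b = 0" "g' c = 0" "g' d \<noteq> 0"
  shows "aff_dim {a, b, c, d} = 3"
proof -
  have 1: "c \<notin> affine hull {a, b}"
    using affine_fun_zero_affine_hull[OF g(1), of "{a,b}" c] g by auto
  have 2: "d \<notin> affine hull {a, b, c}"
    using affine_fun_zero_affine_hull[OF g'(1), of "{a,b,c}" d] g' by auto
  have "{a, b, c, d} = insert d (insert c {a, b})" "{a, b, c} = insert c {a, b}" by auto
  then show ?thesis using 1 2 assms(1) by (simp only: aff_dim_insert if_False) (simp add: aff_dim_2)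
qed

text \<open>The matrix settles everything combinatorial; affinity, signs, boundedness and domination
  cannot be read from it and remain as premises.\<close>

lemma two_two_polytope_check:
  fixes ps :: "(real^4) list"
  assumes chk: "incidence_check (length hs) (map (inc_row hs) ps)"
    and affs: "\<forall>h\<in>set hs. affine_fun h"
    and nonneg: "\<forall>v\<in>set ps. \<forall>h\<in>set hs. 0 \<le> h v"
    and bdd: "bounded (hpoly (set hs))"
    and dom: "\<And>x. x \<in> hpoly (set hs) \<Longrightarrow> \<exists>v\<in>set ps. \<forall>h\<in>set hs. h x = 0 \<longrightarrow> h v = 0"
  shows "two_two_polytope (set ps) (set hs)" "card (set ps) = length ps"
proof -
  let ?rs = "map (inc_row hs) ps" and ?n = "length hs"
  note aff = bspec[OF affs]
  have n2: "2 \<le> ?n" and dist: "distinct ?rs"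
    and uniq: "\<And>r s. r \<in> set ?rs \<Longrightarrow> s \<in> set ?rs \<Longrightarrow> row_le r s \<Longrightarrow> s = r"
    and meet: "\<And>j k. j < ?n \<Longrightarrow> k < ?n \<Longrightarrow> j \<noteq> k \<Longrightarrow> length (filter (\<lambda>r. r ! j \<and> r ! k) ?rs) \<le> 3"
    and flag: "\<And>j. j < ?n \<Longrightarrow> row_flag (filter (\<lambda>r. r ! j) ?rs)"
    and deg: "\<And>r s. r \<in> set ?rs \<Longrightarrow> s \<in> set ?rs \<Longrightarrow> row_edge ?rs r s \<Longrightarrow> length (filter id (row_meet r s)) = 3"
    and cnt: "length (filter (\<lambda>(r, s). row_edge ?rs r s) (List.product ?rs ?rs)) + 20 = 8 * length ?rs"
    using chk unfolding incidence_check_def by auto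
  have dps: "distinct ps" and inj: "inj_on (inc_row hs) (set ps)" using dist by (auto simp: distinct_map)
  show cps: "card (set ps) = length ps" using dps by (rule distinct_card)
  have rowj: "j < ?n \<Longrightarrow> inc_row hs v ! j \<longleftrightarrow> (hs ! j) v = 0" for j v by (simp add: inc_row_def)
  have meet': "card {v \<in> set ps. (hs ! j) v = 0 \<and> (hs ! k) v = 0} \<le> 3"
    if jk: "j < ?n" "k < ?n" "j \<noteq> k" for j k
  proof -
    have "card {v \<in> set ps. (hs ! j) v = 0 \<and> (hs ! k) v = 0}
        \<le> length (filter (\<lambda>v. (hs ! j) v = 0 \<and> (hs ! k) v = 0) ps)"
      by (metis card_length set_filter)
    also have "\<dots> = length (filter (\<lambda>r. r ! j \<and> r ! k) ?rs)"
      using jk by (simp add: filter_map comp_def rowj)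
    finally show ?thesis using meet[OF jk] by simp
  qed
  have fd: "3 \<le> aff_dim {v \<in> set ps. (hs ! j) v = 0}" if j: "j < ?n" for j
  proof -
    have sub: "r \<in> set (filter (\<lambda>r. r ! j) ?rs) \<Longrightarrow> \<exists>v\<in>set ps. (hs ! j) v = 0 \<and> r = inc_row hs v" for r
      using j by (auto simp: rowj)
    obtain a b c d where abcd: "a \<in> set ps" "b \<in> set ps" "c \<in> set ps" "d \<in> set ps"
      "(hs ! j) a = 0" "(hs ! j) b = 0" "(hs ! j) c = 0" "(hs ! j) d = 0"
      "inc_row hs a \<noteq> inc_row hs b" "\<not> row_le (row_meet (inc_row hs a) (inc_row hs b)) (inc_row hs c)"
      "\<not> row_le (row_meet (row_meet (inc_row hs a) (inc_row hs b)) (inc_row hs c)) (inc_row hs d)"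
      using flag[OF j] sub unfolding row_flag_def by metis
    obtain g where g: "g \<in> set hs" "g a = 0" "g b = 0" "g c \<noteq> 0"
      using abcd(10) unfolding inc_row_def row_meet_map row_le_map by blast
    obtain g' where g': "g' \<in> set hs" "g' a = 0" "g' b = 0" "g' c = 0" "g' d \<noteq> 0"
      using abcd(11) unfolding inc_row_def row_meet_map row_le_map by blast
    have "aff_dim {a, b, c, d} = 3"
      using abcd(9) aff_dim_flag[OF _ aff[OF g(1)] g(2-) aff[OF g'(1)] g'(2-)] by auto
    moreover have "aff_dim {a, b, c, d} \<le> aff_dim {v \<in> set ps. (hs ! j) v = 0}"
      using abcd by (intro aff_dim_subset) auto
    ultimately show ?thesis by simp
  qed
  \<comment> \<open>A repeated functional would give a facet with at least four vertices that meets
    itself in at most three. Distinctness turns list lengths into cardinalities.\<close>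
  have dhs: "distinct hs"
  proof (rule ccontr)
    assume "\<not> distinct hs"
    then obtain j k where jk: "j < ?n" "k < ?n" "j \<noteq> k" "hs ! j = hs ! k"
      by (auto simp: distinct_conv_nth)
    have "3 \<le> int (card {v \<in> set ps. (hs ! j) v = 0}) - 1"
      using fd[OF jk(1)] aff_dim_le_card[of "{v \<in> set ps. (hs ! j) v = 0}"] by simp
    then show False using meet'[OF jk(1-3)] jk(4) by simp
  qed
  have ep: "edge_pair (set ps) (set hs) u v \<longleftrightarrow> row_edge ?rs (inc_row hs u) (inc_row hs v)"
    if uv: "u \<in> set ps" "v \<in> set ps" for u v
  proof -
    let ?W = "{w \<in> set ps. \<forall>h\<in>set hs. h u = 0 \<longrightarrow> h v = 0 \<longrightarrow> h w = 0}"
    have le: "row_le (row_meet (inc_row hs u) (inc_row hs v)) (inc_row hs w) \<longleftrightarrow>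
        (\<forall>h\<in>set hs. h u = 0 \<longrightarrow> h v = 0 \<longrightarrow> h w = 0)" for w
      unfolding inc_row_def row_meet_map row_le_map by blast
    have "length (filter (row_le (row_meet (inc_row hs u) (inc_row hs v))) ?rs) = card ?W"
      using dps by (simp add: filter_map comp_def le distinct_length_filter Int_def conj_commute)
    moreover have uW: "{u, v} \<subseteq> ?W" using uv by auto
    moreover have "inc_row hs u = inc_row hs v \<longleftrightarrow> u = v" using inj uv by (auto simp: inj_on_def)
    moreover have "card ?W = 2 \<longleftrightarrow> ?W = {u, v}" if "u \<noteq> v"
      using that uW card_subset_eq[of ?W "{u,v}"] by auto
    ultimately show ?thesis using uv unfolding edge_pair_def row_edge_def by auto
  qed
  show "two_two_polytope (set ps) (set hs)"
  proof
    show "finite (set ps)" "finite (set hs)" by auto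
    show "affine_fun h" if "h \<in> set hs" for h using aff that .
    show "0 \<le> h v" if "v \<in> set ps" "h \<in> set hs" for v h using nonneg that by blast
    show "bounded (hpoly (set hs))" by (rule bdd)
    show "\<exists>v\<in>set ps. \<forall>h\<in>set hs. h x = 0 \<longrightarrow> h v = 0" if "x \<in> hpoly (set hs)" for x using dom that .
    show "w = v" if "v \<in> set ps" "w \<in> set ps" "\<And>h. h \<in> set hs \<Longrightarrow> h v = 0 \<Longrightarrow> h w = 0" for v w
    proof -
      have "row_le (inc_row hs v) (inc_row hs w)" unfolding inc_row_def row_le_map using that(3) by blast
      then have "inc_row hs w = inc_row hs v" using uniq that by simp
      then show ?thesis using inj that by (simp add: inj_on_def)
    qed
    have len: "0 < ?n" "1 < ?n" using n2 by linarith+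
    then have "hs ! 0 \<noteq> hs ! 1" "hs ! 0 \<in> set hs" "hs ! 1 \<in> set hs"
      using nth_eq_iff_index_eq[OF dhs, of 0 1] nth_mem[of _ hs] by auto
    then show "\<exists>h\<in>set hs. \<exists>h'\<in>set hs. h \<noteq> h'" by blast
    show "card {v \<in> set ps. h v = 0 \<and> h' v = 0} \<le> 3" if h: "h \<in> set hs" "h' \<in> set hs" "h \<noteq> h'" for h h'
    proof -
      obtain j k where jk: "j < ?n" "h = hs ! j" "k < ?n" "h' = hs ! k"
        using h(1,2) unfolding in_set_conv_nth by blast
      then have "j \<noteq> k" using h(3) by blast
      then show ?thesis using meet'[OF jk(1,3)] jk(2,4) by simp
    qed
    show "3 \<le> aff_dim {v \<in> set ps. h v = 0}" if h: "h \<in> set hs" for h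
    proof -
      obtain j where "j < ?n" "h = hs ! j" using h unfolding in_set_conv_nth by blast
      then show ?thesis using fd by simp
    qed
    show "card {h \<in> set hs. h u = 0 \<and> h v = 0} = 3" if e: "edge_pair (set ps) (set hs) u v" for u v
    proof -
      have uv: "u \<in> set ps" "v \<in> set ps" using e by (auto simp: edge_pair_def)
      have "length (filter id (row_meet (inc_row hs u) (inc_row hs v))) = length (filter (\<lambda>h. h u = 0 \<and> h v = 0) hs)"
        unfolding inc_row_def row_meet_map by (simp add: filter_map comp_def)
      also have "\<dots> = card {h \<in> set hs. h u = 0 \<and> h v = 0}"
        using dhs by (simp add: distinct_length_filter Int_def conj_commute)
      finally show ?thesis using deg[of "inc_row hs u" "inc_row hs v"] ep[OF uv] e uv by simp
    qed
    show "card (edge_set (set ps) (set hs)) + 10 = 4 * card (set ps)"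
    proof -
      let ?O = "{(u, v). edge_pair (set ps) (set hs) u v}"
      let ?g = "\<lambda>(u, v). (inc_row hs u, inc_row hs v)"
      have "set (filter (\<lambda>(r, s). row_edge ?rs r s) (List.product ?rs ?rs)) = ?g ` ?O"
      proof (intro equalityI subsetI)
        fix p assume "p \<in> set (filter (\<lambda>(r, s). row_edge ?rs r s) (List.product ?rs ?rs))"
        then obtain u v where uv: "u \<in> set ps" "v \<in> set ps" "p = (inc_row hs u, inc_row hs v)"
          "row_edge ?rs (inc_row hs u) (inc_row hs v)" by auto
        then have "(u, v) \<in> ?O" using ep by simp
        then show "p \<in> ?g ` ?O" using uv(3) by force
      next
        fix p assume "p \<in> ?g ` ?O"
        then obtain u v where e: "edge_pair (set ps) (set hs) u v" and p: "p = (inc_row hs u, inc_row hs v)" by auto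
        then have "u \<in> set ps" "v \<in> set ps" by (auto simp: edge_pair_def)
        then show "p \<in> set (filter (\<lambda>(r, s). row_edge ?rs r s) (List.product ?rs ?rs))"
          using ep e p by auto
      qed
      moreover have "distinct (filter (\<lambda>(r, s). row_edge ?rs r s) (List.product ?rs ?rs))"
        using dist by (intro distinct_filter distinct_product)
      ultimately have "length (filter (\<lambda>(r, s). row_edge ?rs r s) (List.product ?rs ?rs)) = card (?g ` ?O)"
        by (metis distinct_card)
      also have "\<dots> = card ?O"
        using inj by (intro card_image) (auto simp: inj_on_def edge_pair_def)
      finally have "card ?O + 20 = 8 * length ps" using cnt by simp
      then show ?thesis using card_edge_set_ordered[of "set ps" "set hs"] cps by simp
    qed
  qed
qed

section \<open>Polytopes with 5, 9, 10 and 11 vertices\<close>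

definition pt :: "real \<Rightarrow> real \<Rightarrow> real \<Rightarrow> real \<Rightarrow> real^4" where
  "pt a b c d = (\<chi> i. if i = 1 then a else if i = 2 then b else if i = 3 then c else d)"

definition aff :: "real \<Rightarrow> real \<Rightarrow> real \<Rightarrow> real \<Rightarrow> real \<Rightarrow> real^4 \<Rightarrow> real" where
  "aff a b c d e = (\<lambda>x. a * x $ 1 + b * x $ 2 + c * x $ 3 + d * x $ 4 + e)"

lemma pt_nth [simp]: "pt a b c d $ 1 = a" "pt a b c d $ 2 = b" "pt a b c d $ 3 = c" "pt a b c d $ 4 = d"
  by (simp_all add: pt_def)

lemma aff_pt: "aff a b c d e (pt p q r s) = a * p + b * q + c * r + d * s + e"
  by (simp add: aff_def)

lemma csum_4: "csum x = x $ 1 + x $ 2 + x $ 3 + x $ 4"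
  by (simp add: csum_def sum_4)

lemma affine_fun_aff: "affine_fun (aff a b c d e)"
  unfolding affine_fun_def aff_def
  by (intro exI[of _ "pt a b c d"] exI[of _ e]) (simp add: inner_vec_def sum_4)

text \<open>On the nonnegative orthant \<open>csum\<close> is the 1-norm.\<close>

lemma bounded_nonneg_csum:
  assumes "\<And>x. x \<in> S \<Longrightarrow> (\<forall>i. 0 \<le> x $ i) \<and> csum x \<le> B"
  shows "bounded S"
proof -
  have "norm x \<le> B" if "x \<in> S" for x
  proof -
    have "norm x \<le> (\<Sum>i\<in>UNIV. \<bar>x $ i\<bar>)" by (rule norm_le_l1_cart)
    also have "\<dots> = csum x" using assms[OF that] by (simp add: csum_def)
    finally show ?thesis using assms[OF that] by linarith
  qed
  then show ?thesis unfolding bounded_iff by blast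
qed

definition simplex_V :: "(real^4) list" where
  "simplex_V = [
    pt 1 0 0 0, pt 0 1 0 0, pt 0 0 1 0, pt 0 0 0 1, pt 0 0 0 0]"

definition simplex_L :: "(real^4 \<Rightarrow> real) list" where
  "simplex_L = [
    aff 1 0 0 0 0, aff 0 1 0 0 0, aff 0 0 1 0 0, aff 0 0 0 1 0, aff (-1) (-1) (-1) (-1) 1]"

lemma simplex_check: "incidence_check (length simplex_L) (map (inc_row simplex_L) simplex_V)"
proof -
  \<comment> \<open>Simplification evaluates the incidences over the reals; what is left to
    \<open>code_simp\<close> is a computation with booleans.\<close>
  have rows: "map (inc_row simplex_L) simplex_V =
     [[False, True, True, True, True], [True, False, True, True, True],
      [True, True, False, True, True], [True, True, True, False, True],
      [True, True, True, True, False]]"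
    by (simp add: simplex_V_def simplex_L_def inc_row_def aff_pt)
  have "length simplex_L = 5" by (simp add: simplex_L_def)
  then show ?thesis unfolding rows by code_simp
qed

text \<open>The clauses list the minimal sets of facets without a common vertex.\<close>
lemma simplex_dominated:
  assumes x: "x \<in> hpoly (set simplex_L)"
  shows "\<exists>v\<in>set simplex_V. \<forall>h\<in>set simplex_L. h x = 0 \<longrightarrow> h v = 0"
proof -
  define t0 where "t0 \<longleftrightarrow> aff 1 0 0 0 0 x = 0"
  define t1 where "t1 \<longleftrightarrow> aff 0 1 0 0 0 x = 0"
  define t2 where "t2 \<longleftrightarrow> aff 0 0 1 0 0 x = 0"
  define t3 where "t3 \<longleftrightarrow> aff 0 0 0 1 0 x = 0"
  define t4 where "t4 \<longleftrightarrow> aff (-1) (-1) (-1) (-1) 1 x = 0"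
  note t = t0_def t1_def t2_def t3_def t4_def
  have pos: "0 \<le> aff 1 0 0 0 0 x" "0 \<le> aff 0 1 0 0 0 x" "0 \<le> aff 0 0 1 0 0 x"
    "0 \<le> aff 0 0 0 1 0 x" "0 \<le> aff (-1) (-1) (-1) (-1) 1 x"
    using x by (simp_all add: hpoly_def simplex_L_def)
  have
    "\<not> (t0 \<and> t1 \<and> t2 \<and> t3 \<and> t4)"
    using pos unfolding t aff_def by linarith+
  \<comment> \<open>One disjunct for each listed vertex, in order: if the facets that miss it are
    slack at \<open>x\<close>, it lies on all facets tight at \<open>x\<close>. If every disjunct
    failed, the tight facets would have no common vertex and contain one of the sets excluded
    above.\<close>
  then have "(\<not> t0) \<or> (\<not> t1) \<or> (\<not> t2) \<or> (\<not> t3) \<or> (\<not> t4)"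
    by argo
  then show ?thesis unfolding simplex_V_def simplex_L_def by (simp add: aff_pt t)
qed

lemma simplex_bounded: "bounded (hpoly (set simplex_L))"
proof (rule bounded_nonneg_csum[of _ 1])
  fix x assume "x \<in> hpoly (set simplex_L)"
  then have "0 \<le> aff 1 0 0 0 0 x" "0 \<le> aff 0 1 0 0 0 x" "0 \<le> aff 0 0 1 0 0 x"
    "0 \<le> aff 0 0 0 1 0 x" "0 \<le> aff (-1) (-1) (-1) (-1) 1 x"
    by (simp_all add: hpoly_def simplex_L_def)
  then show "(\<forall>i. 0 \<le> x $ i) \<and> csum x \<le> 1"
    unfolding aff_def csum_4 forall_4 by linarith
qed

lemma simplex_polytope: "two_two_polytope (set simplex_V) (set simplex_L)"
  and simplex_card: "card (set simplex_V) = 5"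
proof -
  have aff: "\<forall>h\<in>set simplex_L. affine_fun h"
    by (simp add: simplex_L_def affine_fun_aff)
  have nonneg: "\<forall>v\<in>set simplex_V. \<forall>h\<in>set simplex_L. 0 \<le> h v"
    by (simp add: simplex_V_def simplex_L_def aff_pt)
  note chk = two_two_polytope_check[OF simplex_check aff nonneg simplex_bounded simplex_dominated]
  show "two_two_polytope (set simplex_V) (set simplex_L)" using chk(1) by blast
  show "card (set simplex_V) = 5" using chk(2) by (simp add: simplex_V_def)
qed

text \<open>The pyramid over an octahedron, stacked twice beyond opposite tetrahedra so that each new vertex
  lies in three of the old facet hyperplanes; realised with \<open>csum x = 1\<close> as one tetrahedral facet. The last
  vertex is simple and lies on the last four facets only, whose functionals are scaled to take the value 1
  at its neighbours.\<close>
definition nine_V :: "(real^4) list" where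
  "nine_V = [
    pt 1 0 0 0, pt 0 1 0 0, pt 0 0 1 0, pt 0 0 0 1, pt 0 (1/3) (1/3) 0, pt (1/3) 0 (1/3) 0,
    pt (1/3) (1/3) 0 0, pt 0 0 0 (1/2), pt (1/9) (1/9) (1/9) (2/9)]"

definition nine_L :: "(real^4 \<Rightarrow> real) list" where
  "nine_L = [
    aff 1 0 0 0 0, aff 0 1 0 0 0, aff 0 0 1 0 0, aff 0 0 0 1 0, aff (-1) (-1) (-1) (-1) 1,
    aff 3 6 6 6 (-3), aff 6 3 6 6 (-3), aff 6 6 3 6 (-3), aff 12 12 12 18 (-8)]"

lemma nine_check: "incidence_check (length nine_L) (map (inc_row nine_L) nine_V)"
proof -
  have rows: "map (inc_row nine_L) nine_V =
     [[False, True, True, True, True, True, False, False, False],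
      [True, False, True, True, True, False, True, False, False],
      [True, True, False, True, True, False, False, True, False],
      [True, True, True, False, True, False, False, False, False],
      [True, False, False, True, False, False, True, True, True],
      [False, True, False, True, False, True, False, True, True],
      [False, False, True, True, False, True, True, False, True],
      [True, True, True, False, False, True, True, True, False],
      [False, False, False, False, False, True, True, True, True]]"
    by (simp add: nine_V_def nine_L_def inc_row_def aff_pt)
  have "length nine_L = 9" by (simp add: nine_L_def)
  then show ?thesis unfolding rows by code_simp
qed

lemma nine_dominated:
  assumes x: "x \<in> hpoly (set nine_L)"
  shows "\<exists>v\<in>set nine_V. \<forall>h\<in>set nine_L. h x = 0 \<longrightarrow> h v = 0"
proof -
  define t0 where "t0 \<longleftrightarrow> aff 1 0 0 0 0 x = 0"
  define t1 where "t1 \<longleftrightarrow> aff 0 1 0 0 0 x = 0"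
  define t2 where "t2 \<longleftrightarrow> aff 0 0 1 0 0 x = 0"
  define t3 where "t3 \<longleftrightarrow> aff 0 0 0 1 0 x = 0"
  define t4 where "t4 \<longleftrightarrow> aff (-1) (-1) (-1) (-1) 1 x = 0"
  define t5 where "t5 \<longleftrightarrow> aff 3 6 6 6 (-3) x = 0"
  define t6 where "t6 \<longleftrightarrow> aff 6 3 6 6 (-3) x = 0"
  define t7 where "t7 \<longleftrightarrow> aff 6 6 3 6 (-3) x = 0"
  define t8 where "t8 \<longleftrightarrow> aff 12 12 12 18 (-8) x = 0"
  note t = t0_def t1_def t2_def t3_def t4_def t5_def t6_def t7_def t8_def
  have pos: "0 \<le> aff 1 0 0 0 0 x" "0 \<le> aff 0 1 0 0 0 x" "0 \<le> aff 0 0 1 0 0 x"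
    "0 \<le> aff 0 0 0 1 0 x" "0 \<le> aff (-1) (-1) (-1) (-1) 1 x" "0 \<le> aff 3 6 6 6 (-3) x"
    "0 \<le> aff 6 3 6 6 (-3) x" "0 \<le> aff 6 6 3 6 (-3) x" "0 \<le> aff 12 12 12 18 (-8) x"
    using x by (simp_all add: hpoly_def nine_L_def)
  have
    "\<not> (t4 \<and> t8)" "\<not> (t0 \<and> t1 \<and> t8)" "\<not> (t0 \<and> t2 \<and> t8)"
    "\<not> (t0 \<and> t3 \<and> t5)" "\<not> (t0 \<and> t4 \<and> t5)"
    "\<not> (t0 \<and> t5 \<and> t8)" "\<not> (t1 \<and> t2 \<and> t8)"
    "\<not> (t1 \<and> t3 \<and> t6)" "\<not> (t1 \<and> t4 \<and> t6)"
    "\<not> (t1 \<and> t6 \<and> t8)" "\<not> (t2 \<and> t3 \<and> t7)"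
    "\<not> (t2 \<and> t4 \<and> t7)" "\<not> (t2 \<and> t7 \<and> t8)"
    "\<not> (t4 \<and> t5 \<and> t6)" "\<not> (t4 \<and> t5 \<and> t7)"
    "\<not> (t4 \<and> t6 \<and> t7)" "\<not> (t0 \<and> t1 \<and> t2 \<and> t3)"
    "\<not> (t3 \<and> t5 \<and> t6 \<and> t7)"
    using pos unfolding t aff_def by linarith+
  then have "(\<not> t0 \<and> \<not> t6 \<and> \<not> t7 \<and> \<not> t8) \<or>
    (\<not> t1 \<and> \<not> t5 \<and> \<not> t7 \<and> \<not> t8) \<or>
    (\<not> t2 \<and> \<not> t5 \<and> \<not> t6 \<and> \<not> t8) \<or>
    (\<not> t3 \<and> \<not> t5 \<and> \<not> t6 \<and> \<not> t7 \<and> \<not> t8) \<or>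
    (\<not> t1 \<and> \<not> t2 \<and> \<not> t4 \<and> \<not> t5) \<or>
    (\<not> t0 \<and> \<not> t2 \<and> \<not> t4 \<and> \<not> t6) \<or>
    (\<not> t0 \<and> \<not> t1 \<and> \<not> t4 \<and> \<not> t7) \<or>
    (\<not> t3 \<and> \<not> t4 \<and> \<not> t8) \<or>
    (\<not> t0 \<and> \<not> t1 \<and> \<not> t2 \<and> \<not> t3 \<and> \<not> t4)"
    by argo
  then show ?thesis unfolding nine_V_def nine_L_def by (simp add: aff_pt t)
qed

lemma nine_bounded: "bounded (hpoly (set nine_L))"
proof (rule bounded_nonneg_csum[of _ 1])
  fix x assume "x \<in> hpoly (set nine_L)"
  then have "0 \<le> aff 1 0 0 0 0 x" "0 \<le> aff 0 1 0 0 0 x" "0 \<le> aff 0 0 1 0 0 x"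
    "0 \<le> aff 0 0 0 1 0 x" "0 \<le> aff (-1) (-1) (-1) (-1) 1 x" "0 \<le> aff 3 6 6 6 (-3) x"
    "0 \<le> aff 6 3 6 6 (-3) x" "0 \<le> aff 6 6 3 6 (-3) x" "0 \<le> aff 12 12 12 18 (-8) x"
    by (simp_all add: hpoly_def nine_L_def)
  then show "(\<forall>i. 0 \<le> x $ i) \<and> csum x \<le> 1"
    unfolding aff_def csum_4 forall_4 by linarith
qed

lemma nine_polytope: "two_two_polytope (set nine_V) (set nine_L)"
  and nine_card: "card (set nine_V) = 9"
proof -
  have aff: "\<forall>h\<in>set nine_L. affine_fun h"
    by (simp add: nine_L_def affine_fun_aff)
  have nonneg: "\<forall>v\<in>set nine_V. \<forall>h\<in>set nine_L. 0 \<le> h v"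
    by (simp add: nine_V_def nine_L_def aff_pt)
  note chk = two_two_polytope_check[OF nine_check aff nonneg nine_bounded nine_dominated]
  show "two_two_polytope (set nine_V) (set nine_L)" using chk(1) by blast
  show "card (set nine_V) = 9" using chk(2) by (simp add: nine_V_def)
qed

text \<open>The hypersimplex, projectively transformed so that it is a gadget.\<close>
definition ten_V :: "(real^4) list" where
  "ten_V = [
    pt 1 0 0 0, pt 0 1 0 0, pt 0 0 1 0, pt 0 0 0 1, pt (1/3) (1/3) 0 0, pt (1/3) 0 (1/3) 0,
    pt (1/3) 0 0 (1/3), pt 0 (1/3) (1/3) 0, pt 0 (1/3) 0 (1/3), pt 0 0 (1/3) (1/3)]"

definition ten_L :: "(real^4 \<Rightarrow> real) list" where
  "ten_L = [
    aff 1 0 0 0 0, aff 0 1 0 0 0, aff 0 0 1 0 0, aff 0 0 0 1 0, aff (-1) (-1) (-1) (-1) 1,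
    aff 3 3 3 3 (-2), aff 1 2 2 2 (-1), aff 2 1 2 2 (-1), aff 2 2 1 2 (-1), aff 2 2 2 1 (-1)]"

lemma ten_check: "incidence_check (length ten_L) (map (inc_row ten_L) ten_V)"
proof -
  have rows: "map (inc_row ten_L) ten_V =
     [[False, True, True, True, True, False, True, False, False, False],
      [True, False, True, True, True, False, False, True, False, False],
      [True, True, False, True, True, False, False, False, True, False],
      [True, True, True, False, True, False, False, False, False, True],
      [False, False, True, True, False, True, True, True, False, False],
      [False, True, False, True, False, True, True, False, True, False],
      [False, True, True, False, False, True, True, False, False, True],
      [True, False, False, True, False, True, False, True, True, False],
      [True, False, True, False, False, True, False, True, False, True],
      [True, True, False, False, False, True, False, False, True, True]]"
    by (simp add: ten_V_def ten_L_def inc_row_def aff_pt)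
  have "length ten_L = 10" by (simp add: ten_L_def)
  then show ?thesis unfolding rows by code_simp
qed

lemma ten_dominated:
  assumes x: "x \<in> hpoly (set ten_L)"
  shows "\<exists>v\<in>set ten_V. \<forall>h\<in>set ten_L. h x = 0 \<longrightarrow> h v = 0"
proof -
  define t0 where "t0 \<longleftrightarrow> aff 1 0 0 0 0 x = 0"
  define t1 where "t1 \<longleftrightarrow> aff 0 1 0 0 0 x = 0"
  define t2 where "t2 \<longleftrightarrow> aff 0 0 1 0 0 x = 0"
  define t3 where "t3 \<longleftrightarrow> aff 0 0 0 1 0 x = 0"
  define t4 where "t4 \<longleftrightarrow> aff (-1) (-1) (-1) (-1) 1 x = 0"
  define t5 where "t5 \<longleftrightarrow> aff 3 3 3 3 (-2) x = 0"
  define t6 where "t6 \<longleftrightarrow> aff 1 2 2 2 (-1) x = 0"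
  define t7 where "t7 \<longleftrightarrow> aff 2 1 2 2 (-1) x = 0"
  define t8 where "t8 \<longleftrightarrow> aff 2 2 1 2 (-1) x = 0"
  define t9 where "t9 \<longleftrightarrow> aff 2 2 2 1 (-1) x = 0"
  note t = t0_def t1_def t2_def t3_def t4_def t5_def t6_def t7_def t8_def t9_def
  have pos: "0 \<le> aff 1 0 0 0 0 x" "0 \<le> aff 0 1 0 0 0 x" "0 \<le> aff 0 0 1 0 0 x"
    "0 \<le> aff 0 0 0 1 0 x" "0 \<le> aff (-1) (-1) (-1) (-1) 1 x" "0 \<le> aff 3 3 3 3 (-2) x"
    "0 \<le> aff 1 2 2 2 (-1) x" "0 \<le> aff 2 1 2 2 (-1) x" "0 \<le> aff 2 2 1 2 (-1) x"
    "0 \<le> aff 2 2 2 1 (-1) x"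
    using x by (simp_all add: hpoly_def ten_L_def)
  have
    "\<not> (t0 \<and> t6)" "\<not> (t1 \<and> t7)" "\<not> (t2 \<and> t8)" "\<not> (t3 \<and> t9)"
    "\<not> (t4 \<and> t5)" "\<not> (t4 \<and> t6 \<and> t7)" "\<not> (t4 \<and> t6 \<and> t8)"
    "\<not> (t4 \<and> t6 \<and> t9)" "\<not> (t4 \<and> t7 \<and> t8)"
    "\<not> (t4 \<and> t7 \<and> t9)" "\<not> (t4 \<and> t8 \<and> t9)"
    "\<not> (t6 \<and> t7 \<and> t8)" "\<not> (t6 \<and> t7 \<and> t9)"
    "\<not> (t6 \<and> t8 \<and> t9)" "\<not> (t7 \<and> t8 \<and> t9)"
    "\<not> (t0 \<and> t1 \<and> t2 \<and> t3)" "\<not> (t0 \<and> t1 \<and> t2 \<and> t5)"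
    "\<not> (t0 \<and> t1 \<and> t3 \<and> t5)" "\<not> (t0 \<and> t2 \<and> t3 \<and> t5)"
    "\<not> (t1 \<and> t2 \<and> t3 \<and> t5)"
    using pos unfolding t aff_def by linarith+
  then have "(\<not> t0 \<and> \<not> t5 \<and> \<not> t7 \<and> \<not> t8 \<and> \<not> t9) \<or>
    (\<not> t1 \<and> \<not> t5 \<and> \<not> t6 \<and> \<not> t8 \<and> \<not> t9) \<or>
    (\<not> t2 \<and> \<not> t5 \<and> \<not> t6 \<and> \<not> t7 \<and> \<not> t9) \<or>
    (\<not> t3 \<and> \<not> t5 \<and> \<not> t6 \<and> \<not> t7 \<and> \<not> t8) \<or>
    (\<not> t0 \<and> \<not> t1 \<and> \<not> t4 \<and> \<not> t8 \<and> \<not> t9) \<or>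
    (\<not> t0 \<and> \<not> t2 \<and> \<not> t4 \<and> \<not> t7 \<and> \<not> t9) \<or>
    (\<not> t0 \<and> \<not> t3 \<and> \<not> t4 \<and> \<not> t7 \<and> \<not> t8) \<or>
    (\<not> t1 \<and> \<not> t2 \<and> \<not> t4 \<and> \<not> t6 \<and> \<not> t9) \<or>
    (\<not> t1 \<and> \<not> t3 \<and> \<not> t4 \<and> \<not> t6 \<and> \<not> t8) \<or>
    (\<not> t2 \<and> \<not> t3 \<and> \<not> t4 \<and> \<not> t6 \<and> \<not> t7)"
    by argo
  then show ?thesis unfolding ten_V_def ten_L_def by (simp add: aff_pt t)
qed

lemma ten_bounded: "bounded (hpoly (set ten_L))"
proof (rule bounded_nonneg_csum[of _ 1])
  fix x assume "x \<in> hpoly (set ten_L)"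
  then have "0 \<le> aff 1 0 0 0 0 x" "0 \<le> aff 0 1 0 0 0 x" "0 \<le> aff 0 0 1 0 0 x"
    "0 \<le> aff 0 0 0 1 0 x" "0 \<le> aff (-1) (-1) (-1) (-1) 1 x" "0 \<le> aff 3 3 3 3 (-2) x"
    "0 \<le> aff 1 2 2 2 (-1) x" "0 \<le> aff 2 1 2 2 (-1) x" "0 \<le> aff 2 2 1 2 (-1) x"
    "0 \<le> aff 2 2 2 1 (-1) x"
    by (simp_all add: hpoly_def ten_L_def)
  then show "(\<forall>i. 0 \<le> x $ i) \<and> csum x \<le> 1"
    unfolding aff_def csum_4 forall_4 by linarith
qed

lemma ten_polytope: "two_two_polytope (set ten_V) (set ten_L)"
  and ten_card: "card (set ten_V) = 10"
proof -
  have aff: "\<forall>h\<in>set ten_L. affine_fun h"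
    by (simp add: ten_L_def affine_fun_aff)
  have nonneg: "\<forall>v\<in>set ten_V. \<forall>h\<in>set ten_L. 0 \<le> h v"
    by (simp add: ten_V_def ten_L_def aff_pt)
  note chk = two_two_polytope_check[OF ten_check aff nonneg ten_bounded ten_dominated]
  show "two_two_polytope (set ten_V) (set ten_L)" using chk(1) by blast
  show "card (set ten_V) = 10" using chk(2) by (simp add: ten_V_def)
qed

text \<open>The pyramid over an octahedron with four further stacked vertices, framed at one of its simple
  vertices.\<close>
definition eleven_V :: "(real^4) list" where
  "eleven_V = [
    pt 1 0 0 0, pt 0 1 0 0, pt 0 0 1 0, pt 0 0 0 1, pt 0 0 0 0, pt 0 (2/3) (2/3) (1/3),
    pt 1 1 0 2, pt 1 0 1 2, pt 1 1 1 2, pt 5 2 0 6, pt 5 0 2 6]"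

definition eleven_L :: "(real^4 \<Rightarrow> real) list" where
  "eleven_L = [
    aff 1 0 0 0 0, aff 0 1 0 0 0, aff 0 0 1 0 0, aff 0 0 0 1 0, aff (-1) (-1) (-1) 1 1,
    aff (-1) 5 5 (-1) 1, aff 2 (-4) 0 (-1) 4, aff 2 0 (-4) (-1) 4, aff 2 (-1) 0 (-1) 1,
    aff 2 0 (-1) (-1) 1, aff 1 0 0 (-1) 1]"

lemma eleven_check: "incidence_check (length eleven_L) (map (inc_row eleven_L) eleven_V)"
proof -
  have rows: "map (inc_row eleven_L) eleven_V =
     [[False, True, True, True, True, True, False, False, False, False, False],
      [True, False, True, True, True, False, True, False, True, False, False],
      [True, True, False, True, True, False, False, True, False, True, False],
      [True, True, True, False, False, True, False, False, True, True, True],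
      [True, True, True, True, False, False, False, False, False, False, False],
      [True, False, False, False, True, False, False, False, True, True, False],
      [False, False, True, False, False, False, True, False, True, False, True],
      [False, True, False, False, False, False, False, True, False, True, True],
      [False, False, False, False, True, False, True, True, True, True, True],
      [False, False, True, False, True, True, True, False, False, False, True],
      [False, True, False, False, True, True, False, True, False, False, True]]"
    by (simp add: eleven_V_def eleven_L_def inc_row_def aff_pt)
  have "length eleven_L = 11" by (simp add: eleven_L_def)
  then show ?thesis unfolding rows by code_simp
qed

lemma eleven_dominated:
  assumes x: "x \<in> hpoly (set eleven_L)"
  shows "\<exists>v\<in>set eleven_V. \<forall>h\<in>set eleven_L. h x = 0 \<longrightarrow> h v = 0"
proof -
  define t0 where "t0 \<longleftrightarrow> aff 1 0 0 0 0 x = 0"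
  define t1 where "t1 \<longleftrightarrow> aff 0 1 0 0 0 x = 0"
  define t2 where "t2 \<longleftrightarrow> aff 0 0 1 0 0 x = 0"
  define t3 where "t3 \<longleftrightarrow> aff 0 0 0 1 0 x = 0"
  define t4 where "t4 \<longleftrightarrow> aff (-1) (-1) (-1) 1 1 x = 0"
  define t5 where "t5 \<longleftrightarrow> aff (-1) 5 5 (-1) 1 x = 0"
  define t6 where "t6 \<longleftrightarrow> aff 2 (-4) 0 (-1) 4 x = 0"
  define t7 where "t7 \<longleftrightarrow> aff 2 0 (-4) (-1) 4 x = 0"
  define t8 where "t8 \<longleftrightarrow> aff 2 (-1) 0 (-1) 1 x = 0"
  define t9 where "t9 \<longleftrightarrow> aff 2 0 (-1) (-1) 1 x = 0"
  define t10 where "t10 \<longleftrightarrow> aff 1 0 0 (-1) 1 x = 0"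
  note t = t0_def t1_def t2_def t3_def t4_def t5_def t6_def t7_def t8_def t9_def t10_def
  have pos: "0 \<le> aff 1 0 0 0 0 x" "0 \<le> aff 0 1 0 0 0 x" "0 \<le> aff 0 0 1 0 0 x"
    "0 \<le> aff 0 0 0 1 0 x" "0 \<le> aff (-1) (-1) (-1) 1 1 x" "0 \<le> aff (-1) 5 5 (-1) 1 x"
    "0 \<le> aff 2 (-4) 0 (-1) 4 x" "0 \<le> aff 2 0 (-4) (-1) 4 x" "0 \<le> aff 2 (-1) 0 (-1) 1 x"
    "0 \<le> aff 2 0 (-1) (-1) 1 x" "0 \<le> aff 1 0 0 (-1) 1 x"
    using x by (simp_all add: hpoly_def eleven_L_def)
  have
    "\<not> (t1 \<and> t6)" "\<not> (t2 \<and> t7)" "\<not> (t3 \<and> t10)"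
    "\<not> (t0 \<and> t3 \<and> t5)" "\<not> (t0 \<and> t4 \<and> t5)"
    "\<not> (t0 \<and> t4 \<and> t10)" "\<not> (t0 \<and> t5 \<and> t6)"
    "\<not> (t0 \<and> t5 \<and> t7)" "\<not> (t0 \<and> t6 \<and> t7)"
    "\<not> (t0 \<and> t6 \<and> t9)" "\<not> (t0 \<and> t6 \<and> t10)"
    "\<not> (t0 \<and> t7 \<and> t8)" "\<not> (t0 \<and> t7 \<and> t10)"
    "\<not> (t1 \<and> t3 \<and> t8)" "\<not> (t1 \<and> t4 \<and> t8)"
    "\<not> (t1 \<and> t7 \<and> t8)" "\<not> (t2 \<and> t3 \<and> t9)"
    "\<not> (t2 \<and> t4 \<and> t9)" "\<not> (t2 \<and> t6 \<and> t9)"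
    "\<not> (t3 \<and> t5 \<and> t6)" "\<not> (t3 \<and> t5 \<and> t7)"
    "\<not> (t3 \<and> t5 \<and> t8)" "\<not> (t3 \<and> t5 \<and> t9)"
    "\<not> (t3 \<and> t6 \<and> t7)" "\<not> (t3 \<and> t6 \<and> t9)"
    "\<not> (t3 \<and> t7 \<and> t8)" "\<not> (t3 \<and> t8 \<and> t9)"
    "\<not> (t4 \<and> t5 \<and> t8)" "\<not> (t4 \<and> t5 \<and> t9)"
    "\<not> (t5 \<and> t6 \<and> t7)" "\<not> (t5 \<and> t6 \<and> t8)"
    "\<not> (t5 \<and> t6 \<and> t9)" "\<not> (t5 \<and> t7 \<and> t8)"
    "\<not> (t5 \<and> t7 \<and> t9)" "\<not> (t0 \<and> t1 \<and> t2 \<and> t4)"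
    "\<not> (t1 \<and> t2 \<and> t4 \<and> t10)" "\<not> (t1 \<and> t4 \<and> t9 \<and> t10)"
    "\<not> (t2 \<and> t4 \<and> t8 \<and> t10)"
    using pos unfolding t aff_def by linarith+
  then have "(\<not> t0 \<and> \<not> t6 \<and> \<not> t7 \<and> \<not> t8 \<and> \<not> t9 \<and> \<not> t10) \<or>
    (\<not> t1 \<and> \<not> t5 \<and> \<not> t7 \<and> \<not> t9 \<and> \<not> t10) \<or>
    (\<not> t2 \<and> \<not> t5 \<and> \<not> t6 \<and> \<not> t8 \<and> \<not> t10) \<or>
    (\<not> t3 \<and> \<not> t4 \<and> \<not> t6 \<and> \<not> t7) \<or>
    (\<not> t4 \<and> \<not> t5 \<and> \<not> t6 \<and> \<not> t7 \<and> \<not> t8 \<and> \<not> t9 \<and> \<not> t10) \<or>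
    (\<not> t1 \<and> \<not> t2 \<and> \<not> t3 \<and> \<not> t5 \<and> \<not> t6 \<and> \<not> t7 \<and> \<not> t10) \<or>
    (\<not> t0 \<and> \<not> t1 \<and> \<not> t3 \<and> \<not> t4 \<and> \<not> t5 \<and> \<not> t7 \<and> \<not> t9) \<or>
    (\<not> t0 \<and> \<not> t2 \<and> \<not> t3 \<and> \<not> t4 \<and> \<not> t5 \<and> \<not> t6 \<and> \<not> t8) \<or>
    (\<not> t0 \<and> \<not> t1 \<and> \<not> t2 \<and> \<not> t3 \<and> \<not> t5) \<or>
    (\<not> t0 \<and> \<not> t1 \<and> \<not> t3 \<and> \<not> t7 \<and> \<not> t8 \<and> \<not> t9) \<or>
    (\<not> t0 \<and> \<not> t2 \<and> \<not> t3 \<and> \<not> t6 \<and> \<not> t8 \<and> \<not> t9)"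
    by argo
  then show ?thesis unfolding eleven_V_def eleven_L_def by (simp add: aff_pt t)
qed

lemma eleven_bounded: "bounded (hpoly (set eleven_L))"
\<comment> \<open>A generous bound: the largest coordinate sum of a vertex is 13.\<close>
proof (rule bounded_nonneg_csum[of _ 100])
  fix x assume "x \<in> hpoly (set eleven_L)"
  then have "0 \<le> aff 1 0 0 0 0 x" "0 \<le> aff 0 1 0 0 0 x" "0 \<le> aff 0 0 1 0 0 x"
    "0 \<le> aff 0 0 0 1 0 x" "0 \<le> aff (-1) (-1) (-1) 1 1 x" "0 \<le> aff (-1) 5 5 (-1) 1 x"
    "0 \<le> aff 2 (-4) 0 (-1) 4 x" "0 \<le> aff 2 0 (-4) (-1) 4 x" "0 \<le> aff 2 (-1) 0 (-1) 1 x"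
    "0 \<le> aff 2 0 (-1) (-1) 1 x" "0 \<le> aff 1 0 0 (-1) 1 x"
    by (simp_all add: hpoly_def eleven_L_def)
  then show "(\<forall>i. 0 \<le> x $ i) \<and> csum x \<le> 100"
    unfolding aff_def csum_4 forall_4 by linarith
qed

lemma eleven_polytope: "two_two_polytope (set eleven_V) (set eleven_L)"
  and eleven_card: "card (set eleven_V) = 11"
proof -
  have aff: "\<forall>h\<in>set eleven_L. affine_fun h"
    by (simp add: eleven_L_def affine_fun_aff)
  have nonneg: "\<forall>v\<in>set eleven_V. \<forall>h\<in>set eleven_L. 0 \<le> h v"
    by (simp add: eleven_V_def eleven_L_def aff_pt)
  note chk = two_two_polytope_check[OF eleven_check aff nonneg eleven_bounded eleven_dominated]
  show "two_two_polytope (set eleven_V) (set eleven_L)" using chk(1) by blast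
  show "card (set eleven_V) = 11" using chk(2) by (simp add: eleven_V_def)
qed

section \<open>The explicit polytopes as framed polytopes and gadgets\<close>

lemma pt_eqs:
  "pt 0 0 0 0 = 0" "pt 1 0 0 0 = unit 1" "pt 0 1 0 0 = unit 2" "pt 0 0 1 0 = unit 3" "pt 0 0 0 1 = unit 4"
  by (simp_all add: vec_eq_iff forall_4 unit_nth)

lemma aff_eqs:
  "aff 1 0 0 0 0 = coord 1" "aff 0 1 0 0 0 = coord 2" "aff 0 0 1 0 0 = coord 3" "aff 0 0 0 1 0 = coord 4"
  "aff (-1) (-1) (-1) (-1) 1 = (\<lambda>x. 1 - csum x)"
  by (auto simp: aff_def csum_4)

lemma aff_0: "aff a b c d e 0 = e"
  by (simp add: aff_def)

lemma aff_unit: "aff a b c d e (unit 1) = a + e" "aff a b c d e (unit 2) = b + e"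
  "aff a b c d e (unit 3) = c + e" "aff a b c d e (unit 4) = d + e"
  by (simp_all add: aff_def unit_nth)

lemma exists_4: "(\<exists>i::4. P i) \<longleftrightarrow> P 1 \<or> P 2 \<or> P 3 \<or> P 4"
  using forall_4[of "\<lambda>i. \<not> P i"] by blast

text \<open>Object-level quantifiers over \<open>V\<close> and \<open>L\<close> let simplification
  unfold the locale assumptions over explicit lists. One disjunction covers \<open>far\<close> and
  \<open>far_zero\<close>, because \<open>1 < csum v\<close> already excludes 0 and the unit
  vectors.\<close>

lemma framed_polytopeI:
  assumes "two_two_polytope V L"
    and "\<forall>i. coord i \<in> L" "0 \<in> V" "\<forall>i. unit i \<in> V"
    and far: "\<forall>v\<in>V. v = 0 \<or> (\<exists>i. v = unit i) \<or> 1 < csum v \<and> (\<forall>i j. v $ i = 0 \<longrightarrow> v $ j = 0 \<longrightarrow> i = j)"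
    and nc: "\<forall>h\<in>L. (\<exists>i. h = coord i) \<or> 0 < h 0"
    and cap: "\<forall>i j. i \<noteq> j \<longrightarrow> (\<exists>h\<in>L. 0 < h 0 \<and> h (unit i) = 0 \<and> h (unit j) = 0)"
  shows "framed_polytope V L"
proof -
  interpret two_two_polytope V L by fact
  show ?thesis
  proof
    show "coord i \<in> L" "unit i \<in> V" "0 \<in> V" for i using assms by auto
    show "1 < csum v" if "v \<in> V" "v \<noteq> 0" "\<And>i. v \<noteq> unit i" for v using far that by blast
    show "i = j" if v: "v \<in> V" "1 < csum v" "v $ i = 0" "v $ j = 0" for v i j
    proof -
      have "v \<noteq> 0" "\<nexists>i. v = unit i" using v(2) by auto
      then show ?thesis using far v by blast
    qed
    show "0 < h 0" if "h \<in> L" "\<And>i. h \<noteq> coord i" for h using nc that by blast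
    show "\<exists>h\<in>L. 0 < h 0 \<and> h (unit i) = 0 \<and> h (unit j) = 0" if "i \<noteq> j" for i j using cap that by blast
  qed
qed

lemma gadgetI:
  assumes "two_two_polytope V L"
    and "\<forall>i. coord i \<in> L" "(\<lambda>x. 1 - csum x) \<in> L" "\<forall>i. unit i \<in> V"
    and near: "\<forall>v\<in>V. (\<exists>i. v = unit i) \<or> csum v < 1"
    and nc: "\<forall>h\<in>L. (\<exists>i. h = coord i) \<or> h = (\<lambda>x. 1 - csum x) \<or> h 0 < 0"
  shows "gadget V L"
proof -
  interpret two_two_polytope V L by fact
  show ?thesis using assms by unfold_locales blast+
qed

lemma simplex_framed: "framed_polytope (set simplex_V) (set simplex_L)"
  by (rule framed_polytopeI[OF simplex_polytope])
    (simp_all add: simplex_V_def simplex_L_def pt_eqs aff_eqs forall_4 coord_inj)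

lemma eleven_framed: "framed_polytope (set eleven_V) (set eleven_L)"
  by (rule framed_polytopeI[OF eleven_polytope])
    (simp_all add: eleven_V_def eleven_L_def pt_eqs aff_eqs aff_0 aff_unit forall_4 coord_inj csum_4 unit_nth)

lemma nine_gadget: "gadget (set nine_V) (set nine_L)"
  by (rule gadgetI[OF nine_polytope])
    (simp_all add: nine_V_def nine_L_def pt_eqs aff_eqs aff_0 forall_4 coord_inj csum_4)

lemma ten_gadget: "gadget (set ten_V) (set ten_L)"
  by (rule gadgetI[OF ten_polytope])
    (simp_all add: ten_V_def ten_L_def pt_eqs aff_eqs aff_0 forall_4 coord_inj csum_4)

text \<open>The new coordinates are the functionals of the four facets at the simple vertex of
  \<open>nine_V\<close>. That vertex goes to 0 and, by the scaling of the functionals, its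
  neighbours go to the unit vectors.\<close>

definition nine_map :: "real^4 \<Rightarrow> real^4" where
  "nine_map x = pt (aff 3 6 6 6 (-3) x) (aff 6 3 6 6 (-3) x) (aff 6 6 3 6 (-3) x) (aff 12 12 12 18 (-8) x)"

text \<open>The constant terms are the simple vertex; the coefficients of each coordinate of
  \<open>y\<close> form the difference between a neighbour and that vertex.\<close>

definition nine_inv :: "real^4 \<Rightarrow> real^4" where
  "nine_inv y = pt (aff (-1/9) (2/9) (2/9) (-1/9) (1/9) y) (aff (2/9) (-1/9) (2/9) (-1/9) (1/9) y)
     (aff (2/9) (2/9) (-1/9) (-1/9) (1/9) y) (aff (-2/9) (-2/9) (-2/9) (5/18) (2/9) y)"

lemma nine_inverse: "nine_inv (nine_map x) = x" "nine_map (nine_inv x) = x"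
  by (simp_all add: nine_map_def nine_inv_def vec_eq_iff forall_4 aff_def field_simps)

lemma linear_pt_aff: "linear (\<lambda>x. pt (aff a b c d 0 x) (aff a' b' c' d' 0 x) (aff a'' b'' c'' d'' 0 x) (aff p q r s 0 x))"
  by (rule linearI) (simp_all add: vec_eq_iff forall_4 aff_def algebra_simps)

text \<open>The simple vertex of the inserted piece survives the gluing and becomes the next origin,
  so the step can be iterated. Each step adds 9 - 5 = 4 vertices.\<close>

lemma nine_glue_framed:
  assumes "framed_polytope V L"
  shows "\<exists>V' L'. framed_polytope V' L' \<and> card V' = card V + 4"
proof -
  interpret R: framed_polytope V L by fact
  interpret gluing "set nine_V" "set nine_L" V L
    by (intro gluing.intro nine_gadget assms)
  let ?V = "nine_map ` VS" and ?L = "(\<lambda>h. h \<circ> nine_inv) ` LS"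
  have tt: "two_two_polytope ?V ?L"
  proof (rule two_two_polytope_affine_image[OF glued])
    show "nine_map = (\<lambda>x. pt (aff 3 6 6 6 0 x) (aff 6 3 6 6 0 x) (aff 6 6 3 6 0 x) (aff 12 12 12 18 0 x)
        + pt (-3) (-3) (-3) (-8))"
      by (simp add: fun_eq_iff nine_map_def vec_eq_iff forall_4 aff_def)
    show "nine_inv = (\<lambda>y. pt (aff (-1/9) (2/9) (2/9) (-1/9) 0 y) (aff (2/9) (-1/9) (2/9) (-1/9) 0 y)
     (aff (2/9) (2/9) (-1/9) (-1/9) 0 y) (aff (-2/9) (-2/9) (-2/9) (5/18) 0 y) + pt (1/9) (1/9) (1/9) (2/9))"
      by (simp add: fun_eq_iff nine_inv_def vec_eq_iff forall_4 aff_def)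
  qed (rule linear_pt_aff nine_inverse)+
  let ?y = "pt (1/9) (1/9) (1/9) (2/9)"
  have inv0: "nine_inv 0 = ?y" by (simp add: nine_inv_def aff_0)
  have inv_unit: "nine_inv (unit 1) = pt 0 (1/3) (1/3) 0" "nine_inv (unit 2) = pt (1/3) 0 (1/3) 0"
    "nine_inv (unit 3) = pt (1/3) (1/3) 0 0" "nine_inv (unit 4) = pt 0 0 0 (1/2)"
    by (simp_all add: nine_inv_def aff_unit)
  have coord_comp: "coord 1 = aff 3 6 6 6 (-3) \<circ> nine_inv" "coord 2 = aff 6 3 6 6 (-3) \<circ> nine_inv"
    "coord 3 = aff 6 6 3 6 (-3) \<circ> nine_inv" "coord 4 = aff 12 12 12 18 (-8) \<circ> nine_inv"
    by (auto simp: fun_eq_iff nine_inv_def aff_pt) (simp_all add: aff_def field_simps)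
  have VP_VS_nine: "v \<in> nine_map ` VS" if "nine_inv v \<in> set nine_V" for v
    using VP_VS[OF that] nine_inverse(2)[of v] by (metis imageI)
  have "framed_polytope ?V ?L"
  proof (rule framed_polytopeI[OF tt])
    have "aff 3 6 6 6 (-3) \<in> LS" "aff 6 3 6 6 (-3) \<in> LS" "aff 6 6 3 6 (-3) \<in> LS"
      "aff 12 12 12 18 (-8) \<in> LS"
      by (rule inner_LS, simp add: nine_L_def, simp add: aff_0)+
    then show "\<forall>i. coord i \<in> ?L"
      unfolding forall_4 coord_comp by blast
    show "0 \<in> ?V" by (rule VP_VS_nine) (simp add: inv0 nine_V_def)
    have "nine_inv (unit i) \<in> set nine_V" for i
      using exhaust_4[of i] by (auto simp: inv_unit nine_V_def)
    then show "\<forall>i. unit i \<in> ?V" using VP_VS_nine by blast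
    show "\<forall>v\<in>?V. v = 0 \<or> (\<exists>i. v = unit i) \<or> 1 < csum v \<and> (\<forall>i j. v $ i = 0 \<longrightarrow> v $ j = 0 \<longrightarrow> i = j)"
    proof
      fix v assume "v \<in> ?V"
      then obtain w where w: "w \<in> VS" "v = nine_map w" by blast
      have "\<forall>w\<in>set nine_V. nine_map w = 0 \<or> (\<exists>i. nine_map w = unit i) \<or>
          1 < csum (nine_map w) \<and> (\<forall>i j. nine_map w $ i = 0 \<longrightarrow> nine_map w $ j = 0 \<longrightarrow> i = j)"
        by (simp add: nine_V_def nine_map_def aff_pt pt_eqs aff_unit csum_4 forall_4)
      moreover have "1 < csum v \<and> (\<forall>i j. v $ i = 0 \<longrightarrow> v $ j = 0 \<longrightarrow> i = j)" if "w \<notin> set nine_V"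
      proof -
        have B: "w \<in> B" using w that VS_cases by blast
        then have "1 < csum w" using that P.unit_in B_cases by metis
        moreover have "0 \<le> w $ 1" "0 \<le> w $ 2" "0 \<le> w $ 3" "0 \<le> w $ 4" using B B_nonneg by blast+
        \<comment> \<open>The first three new coordinates are at least \<open>3 * csum w - 3\<close>
          and the fourth is at least \<open>12 * csum w - 8\<close>.\<close>
        ultimately have "0 < v $ 1" "0 < v $ 2" "0 < v $ 3" "0 < v $ 4" "1 < csum v"
          unfolding w(2) nine_map_def csum_4 pt_nth aff_def by linarith+
        then show ?thesis by (simp add: forall_4)
      qed
      ultimately show "v = 0 \<or> (\<exists>i. v = unit i) \<or> 1 < csum v \<and> (\<forall>i j. v $ i = 0 \<longrightarrow> v $ j = 0 \<longrightarrow> i = j)"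
        using w(2) by blast
    qed
    show "\<forall>h\<in>?L. (\<exists>i. h = coord i) \<or> 0 < h 0"
    proof
      fix h assume "h \<in> ?L"
      then obtain g where g: "g \<in> LS" "h = g \<circ> nine_inv" by blast
      have h0: "h 0 = g ?y" using g inv0 by simp
      from g(1) show "(\<exists>i. h = coord i) \<or> 0 < h 0"
      proof (cases rule: LS_cases)
        case (1 i)
        then show ?thesis using h0 exhaust_4[of i] by auto
      next
        case 2
        have "\<forall>g\<in>set nine_L. (\<exists>i. g \<circ> nine_inv = coord i) \<or> 0 < g ?y"
          unfolding nine_L_def by (auto simp: aff_pt coord_comp[symmetric])
        then show ?thesis using 2(1) g(2) h0 by auto
      next
        case 3
        have "0 < g ?y" by (rule outer_pos[OF 3]) (auto simp: csum_4 pt_def)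
        then show ?thesis using h0 by simp
      qed
    qed
    show "\<forall>i j. i \<noteq> j \<longrightarrow> (\<exists>h\<in>?L. 0 < h 0 \<and> h (unit i) = 0 \<and> h (unit j) = 0)"
    proof (intro allI impI)
      fix i j :: 4 assume ij: "i \<noteq> j"
      \<comment> \<open>The old coordinate hyperplanes serve as caps: any two neighbours of the
        simple vertex share a zero coordinate, while that vertex has none.\<close>
      have "\<exists>m. 0 < nine_inv 0 $ m \<and> nine_inv (unit i) $ m = 0 \<and> nine_inv (unit j) $ m = 0"
        using ij exhaust_4[of i] exhaust_4[of j] unfolding inv0 by (auto simp: inv_unit exists_4)
      then obtain m where m: "0 < (coord m \<circ> nine_inv) 0" "(coord m \<circ> nine_inv) (unit i) = 0"
        "(coord m \<circ> nine_inv) (unit j) = 0" by auto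
      then show "\<exists>h\<in>?L. 0 < h 0 \<and> h (unit i) = 0 \<and> h (unit j) = 0" using coord_LS by blast
    qed
  qed
  moreover have "card ?V = card V + 4"
  proof -
    have "inj nine_map" using nine_inverse(1) by (metis injI)
    then have "card ?V = card VS" by (simp add: card_image inj_on_subset)
    then show ?thesis using card_VS nine_card by simp
  qed
  ultimately show ?thesis by blast
qed

section \<open>All admissible vertex numbers\<close>

lemma framed_series:
  assumes "framed_polytope V L"
  shows "\<exists>V' L'. framed_polytope V' L' \<and> card V' = card V + 4 * a"
proof (induction a)
  case 0
  then show ?case using assms by auto
next
  case (Suc a)
  then obtain V' L' where "framed_polytope V' L'" "card V' = card V + 4 * a" by blast
  then show ?case using nine_glue_framed[of V' L'] by (metis add.assoc mult_Suc_right add.commute)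
qed

text \<open>The hypersimplex adds 10 - 5 = 5 vertices. Each of its vertices lies on five facets, so
  it supplies no simple vertex for a further gluing and comes last.\<close>

lemma framed_realizes:
  assumes "framed_polytope V L"
  shows "\<exists>P :: (real^4) set. polytope P \<and> aff_dim P = 4 \<and> fnum 0 P = card V
           \<and> two_simple4 P \<and> two_simplicial P \<and> elementary 4 P"
    and "\<exists>P :: (real^4) set. polytope P \<and> aff_dim P = 4 \<and> fnum 0 P = card V + 5
           \<and> two_simple4 P \<and> two_simplicial P \<and> elementary 4 P"
proof -
  interpret framed_polytope V L by fact
  show "\<exists>P :: (real^4) set. polytope P \<and> aff_dim P = 4 \<and> fnum 0 P = card V
           \<and> two_simple4 P \<and> two_simplicial P \<and> elementary 4 P"
    using realizes by blast
  interpret G: gluing "set ten_V" "set ten_L" V L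
    by (intro gluing.intro ten_gadget assms)
  interpret S: two_two_polytope G.VS G.LS by (rule G.glued)
  have "card G.VS = card V + 5" using G.card_VS ten_card by simp
  then show "\<exists>P :: (real^4) set. polytope P \<and> aff_dim P = 4 \<and> fnum 0 P = card V + 5
           \<and> two_simple4 P \<and> two_simplicial P \<and> elementary 4 P"
    using S.realizes by metis
qed

theorem theorem4p3:
  fixes k :: nat
  assumes "k \<in> {5, 9, 10, 11} \<or> k \<ge> 13"
  shows "\<exists>P :: (real^4) set. polytope P \<and> aff_dim P = 4 \<and> fnum 0 P = k
           \<and> two_simple4 P \<and> two_simplicial P \<and> elementary 4 P"
proof -
  \<comment> \<open>The four families are the residue classes 1, 3, 2 and 0 modulo 4, starting at 5,
    11, 10 and 16; from 5 on they miss just 6, 7, 8 and 12.\<close>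
  have "\<exists>a. k = 5 + 4 * a \<or> k = 11 + 4 * a \<or> k = 5 + 4 * a + 5 \<or> k = 11 + 4 * a + 5"
    using assms by (auto; presburger)
  then obtain a where a: "k = 5 + 4 * a \<or> k = 11 + 4 * a \<or> k = 5 + 4 * a + 5 \<or> k = 11 + 4 * a + 5" ..
  obtain V L where V: "framed_polytope V L" "card V = 5 + 4 * a"
    using framed_series[OF simplex_framed, of a] simplex_card by auto
  obtain W M where W: "framed_polytope W M" "card W = 11 + 4 * a"
    using framed_series[OF eleven_framed, of a] eleven_card by auto
  show ?thesis
    using framed_realizes[OF V(1)] framed_realizes[OF W(1)] a V(2) W(2) by auto
qed

end
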